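(* For every primitive $p$-tuple $a=(a_1,\dots,a_p)$, there is a constant $r(a)$ (depending only on $a$) and an algorithm that, given any independence system $S\subseteq\{0,1\}^n$ presented by a linear-optimization oracle, weight vector $w\in\{a_1,\dots,a_p\}^n$, and function $f:\mathbb{Z}\rightarrow\mathbb{R}$ presented by a comparison oracle, provides an $r(a)$-best solution to the nonlinear problem $\min\{f(wx) : x\in S\}$, in time polynomial in $n$. Moreover: 1. If $a_i$ divides $a_{i+1}$ for $i=1,\dots,p-1$, then the algorithm provides an optimal solution. 2. For $p=2$, that is, for $a=(a_1,a_2)$, the algorithm provides an $\mathrm{F}(a)$-best solution.
   Context: A $p$-tuple $a=(a_1,\dots,a_p)$ is primitive if the $a_i$ are distinct positive integers with $\gcd(a_1,\dots,a_p)=1$. An independence system is a nonempty set $S\subseteq\{0,1\}^n$ such that $x\in\{0,1\}^n$ and $x\le y\in S$ (componentwise) imply $x\in S$. For $v\in\mathbb{Z}^n$ and $x\in\{0,1\}^n$, $vx:=\sum_{j=1}^n v_jx_j$. A linear-optimization oracle for $S$, queried on $v\in\mathbb{Z}^n$, returns an element $x\in S$ maximizing $vx$ over $S$. A comparison oracle for $f$, queried on $x,y\in\mathbb{Z}$, asserts whether or not $f(x)\le f(y)$. Running time is measured in the usual oracle model, each oracle query counting as one step; the tuple $a$ is fixed and is not part of the input. For a nonnegative integer $r$, a point $x^*\in S$ is an $r$-best solution if $|\{f(wx) : f(wx)<f(wx^* ),\ x\in S\}|\le r$; a $0$-best solution is the same as an optimal solution. The Frobenius number $\mathrm{F}(a)$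 of a primitive tuple $a$ with all $a_i\ge 2$ is the largest integer that is not expressible as a nonnegative integer combination of the $a_i$; if some $a_i=1$, then $\mathrm{F}(a):=0$ by convention. *)

theory Defs
  imports
    "Jordan_Normal_Form.Matrix"
    "HOL-Computational_Algebra.Polynomial"
begin

section \<open>Nonlinear optimization over independence systems\<close>

text \<open>A tuple \<open>(a\<^sub>1, \<dots>, a\<^sub>p)\<close> is a list, so \<open>a\<^sub>i\<close> is \<open>a ! (i - 1)\<close> and \<open>p = length a\<close>.
  The gcd condition excludes \<open>p = 0\<close>, as the gcd of the empty set is 0.\<close>

definition primitive_tuple :: "nat list \<Rightarrow> bool" where
  "primitive_tuple a \<longleftrightarrow> distinct a \<and> (\<forall>i < length a. a ! i > 0) \<and> Gcd (set a) = 1"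

definition zero_one_vecs :: "nat \<Rightarrow> int vec set" where
  "zero_one_vecs n = {x \<in> carrier_vec n. \<forall>i < n. x $ i \<in> {0, 1}}"

definition independence_system :: "nat \<Rightarrow> int vec set \<Rightarrow> bool" where
  "independence_system n S \<longleftrightarrow>
     S \<noteq> {} \<and> S \<subseteq> zero_one_vecs n \<and> (\<forall>x \<in> zero_one_vecs n. \<forall>y \<in> S. x \<le> y \<longrightarrow> x \<in> S)"

definition r_best_solution :: "nat \<Rightarrow> int vec set \<Rightarrow> int vec \<Rightarrow> (int \<Rightarrow> real) \<Rightarrow> int vec \<Rightarrow> bool" where
  "r_best_solution r S w f x' \<longleftrightarrow>
     x' \<in> S \<and> card {f (w \<bullet> x) | x. f (w \<bullet> x) < f (w \<bullet> x') \<and> x \<in> S} \<le> r"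

definition optimal_solution :: "int vec set \<Rightarrow> int vec \<Rightarrow> (int \<Rightarrow> real) \<Rightarrow> int vec \<Rightarrow> bool" where
  "optimal_solution S w f x' \<longleftrightarrow> x' \<in> S \<and> (\<forall>x \<in> S. f (w \<bullet> x') \<le> f (w \<bullet> x))"

text \<open>If all entries of a primitive tuple are at least 2, then 1 is not representable, so the
  greatest integer below is positive and the conversion to \<^typ>\<open>nat\<close> is harmless.\<close>

definition frobenius :: "nat list \<Rightarrow> nat" where
  "frobenius a =
     (if 1 \<in> set a then 0
      else nat (GREATEST m :: int. \<not> (\<exists>c :: nat \<Rightarrow> nat. m = (\<Sum>i < length a. int (c i) * int (a ! i)))))"


section \<open>Oracles\<close>

definition lin_opt_oracle :: "nat \<Rightarrow> int vec set \<Rightarrow> (int vec \<Rightarrow> int vec) \<Rightarrow> bool" where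
  "lin_opt_oracle n S LO \<longleftrightarrow>
     (\<forall>v \<in> carrier_vec n. LO v \<in> S \<and> (\<forall>x \<in> S. v \<bullet> x \<le> v \<bullet> LO v))"

definition comparison_oracle :: "(int \<Rightarrow> real) \<Rightarrow> int \<Rightarrow> int \<Rightarrow> bool" where
  "comparison_oracle f = (\<lambda>x y. f x \<le> f y)"


section \<open>Oracle algorithms and their running time\<close>

text \<open>Algorithms are programs of a random access machine with integer registers and integer
  arrays. The only arithmetic operations are addition and subtraction, each costing one step, so
  bit lengths grow by at most a constant (depending on the program) per step. The model is
  therefore polynomially equivalent to Turing machines; a unit-cost multiplication would destroy
  this property and is deliberately absent.\<close>

datatype aexp =
    Const int
  | Reg nat
  | Arr nat aexp   \<comment> \<open>array name and index\<close>
  | Plus aexp aexp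
  | Minus aexp aexp

record state =
  regs :: "nat \<Rightarrow> int"
  arrs :: "nat \<Rightarrow> int \<Rightarrow> int"

primrec aval :: "aexp \<Rightarrow> state \<Rightarrow> int" where
  "aval (Const k) s = k"
| "aval (Reg x) s = regs s x"
| "aval (Arr A e) s = arrs s A (aval e s)"
| "aval (Plus e1 e2) s = aval e1 s + aval e2 s"
| "aval (Minus e1 e2) s = aval e1 s - aval e2 s"

primrec atime :: "aexp \<Rightarrow> nat" where
  "atime (Const k) = 1"
| "atime (Reg x) = 1"
| "atime (Arr A e) = 1 + atime e"
| "atime (Plus e1 e2) = 1 + atime e1 + atime e2"
| "atime (Minus e1 e2) = 1 + atime e1 + atime e2"

datatype com =
    Skip
  | Assign nat aexp
  | Store nat aexp aexp          \<comment> \<open>array name, index, new value\<close>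
  | Seq com com
  | Cond aexp com com
  | While aexp com               \<comment> \<open>tests of \<open>Cond\<close> and \<open>While\<close> succeed iff the value is positive\<close>
  | LinOpt nat nat               \<comment> \<open>query on the vector in the first array, answer to the second\<close>
  | Compare nat aexp aexp        \<comment> \<open>sets the register to 1 or 0\<close>

definition vec_of_array :: "nat \<Rightarrow> (int \<Rightarrow> int) \<Rightarrow> int vec" where
  "vec_of_array n h = vec n (\<lambda>i. h (int i))"

definition write_vec :: "nat \<Rightarrow> int vec \<Rightarrow> (int \<Rightarrow> int) \<Rightarrow> (int \<Rightarrow> int)" where
  "write_vec n x h = (\<lambda>i. if 0 \<le> i \<and> i < int n then x $ nat i else h i)"

text \<open>\<open>exec n LO cmp c s t s'\<close>: in dimension \<open>n\<close>, with linear-optimization oracle \<open>LO\<close> and comparison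
  oracle \<open>cmp\<close>, the program \<open>c\<close> started in state \<open>s\<close> terminates after \<open>t\<close> steps in state \<open>s'\<close>.\<close>

inductive exec ::
  "nat \<Rightarrow> (int vec \<Rightarrow> int vec) \<Rightarrow> (int \<Rightarrow> int \<Rightarrow> bool) \<Rightarrow> com \<Rightarrow> state \<Rightarrow> nat \<Rightarrow> state \<Rightarrow> bool"
  for n :: nat and LO :: "int vec \<Rightarrow> int vec" and cmp :: "int \<Rightarrow> int \<Rightarrow> bool" where
  Skip: "exec n LO cmp Skip s 1 s"
| Assign: "exec n LO cmp (Assign x e) s (1 + atime e) (s\<lparr>regs := (regs s)(x := aval e s)\<rparr>)"
| Store: "exec n LO cmp (Store A e1 e2) s (1 + atime e1 + atime e2)
    (s\<lparr>arrs := (arrs s)(A := (arrs s A)(aval e1 s := aval e2 s))\<rparr>)"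
| Seq: "exec n LO cmp c1 s1 t1 s2 \<Longrightarrow> exec n LO cmp c2 s2 t2 s3 \<Longrightarrow>
    exec n LO cmp (Seq c1 c2) s1 (t1 + t2) s3"
| CondTrue: "aval e s > 0 \<Longrightarrow> exec n LO cmp c1 s t s' \<Longrightarrow>
    exec n LO cmp (Cond e c1 c2) s (1 + atime e + t) s'"
| CondFalse: "\<not> aval e s > 0 \<Longrightarrow> exec n LO cmp c2 s t s' \<Longrightarrow>
    exec n LO cmp (Cond e c1 c2) s (1 + atime e + t) s'"
| WhileFalse: "\<not> aval e s > 0 \<Longrightarrow> exec n LO cmp (While e c) s (1 + atime e) s"
| WhileTrue: "aval e s1 > 0 \<Longrightarrow> exec n LO cmp c s1 t1 s2 \<Longrightarrow> exec n LO cmp (While e c) s2 t2 s3 \<Longrightarrow>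
    exec n LO cmp (While e c) s1 (1 + atime e + t1 + t2) s3"
| LinOpt: "exec n LO cmp (LinOpt A B) s 1
    (s\<lparr>arrs := (arrs s)(B := write_vec n (LO (vec_of_array n (arrs s A))) (arrs s B))\<rparr>)"
| Compare: "exec n LO cmp (Compare x e1 e2) s (1 + atime e1 + atime e2)
    (s\<lparr>regs := (regs s)(x := (if cmp (aval e1 s) (aval e2 s) then 1 else 0))\<rparr>)"

inductive_cases exec_SkipE: "exec n LO cmp Skip s t s'"
inductive_cases exec_AssignE: "exec n LO cmp (Assign x e) s t s'"
inductive_cases exec_StoreE: "exec n LO cmp (Store A e1 e2) s t s'"
inductive_cases exec_SeqE: "exec n LO cmp (Seq c1 c2) s t s'"
inductive_cases exec_CondE: "exec n LO cmp (Cond e c1 c2) s t s'"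
inductive_cases exec_WhileE: "exec n LO cmp (While e c) s t s'"
inductive_cases exec_LinOptE: "exec n LO cmp (LinOpt A B) s t s'"
inductive_cases exec_CompareE: "exec n LO cmp (Compare x e1 e2) s t s'"

text \<open>Execution is deterministic, so final state and running time are functions of the input.\<close>

lemma exec_deterministic:
  "exec n LO cmp c s t s' \<Longrightarrow> exec n LO cmp c s u s'' \<Longrightarrow> t = u \<and> s' = s''"
proof (induction arbitrary: u s'' rule: exec.induct)
  case Skip
  then show ?case by (rule exec_SkipE) simp
next
  case Assign
  then show ?case by (rule exec_AssignE) simp
next
  case Store
  then show ?case by (rule exec_StoreE) simp
next
  case (Seq c1 s1 t1 s2 c2 t2 s3)
  from Seq.prems obtain t1' t2' s2' where
    "u = t1' + t2'" "exec n LO cmp c1 s1 t1' s2'" "exec n LO cmp c2 s2' t2' s''"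
    by (cases rule: exec_SeqE)
  then show ?case using Seq.IH(1)[of t1' s2'] Seq.IH(2)[of t2' s''] by simp
next
  case (CondTrue e s c1 t s' c2)
  from CondTrue.prems CondTrue.hyps(1) obtain t' where
    "u = 1 + atime e + t'" "exec n LO cmp c1 s t' s''"
    by (cases rule: exec_CondE) auto
  then show ?case using CondTrue.IH[of t' s''] by simp
next
  case (CondFalse e s c2 t s' c1)
  from CondFalse.prems CondFalse.hyps(1) obtain t' where
    "u = 1 + atime e + t'" "exec n LO cmp c2 s t' s''"
    by (cases rule: exec_CondE) auto
  then show ?case using CondFalse.IH[of t' s''] by simp
next
  case (WhileFalse e s c)
  from WhileFalse.prems WhileFalse.hyps show ?case
    by (cases rule: exec_WhileE) auto
next
  case (WhileTrue e s1 c t1 s2 t2 s3)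
  from WhileTrue.prems WhileTrue.hyps(1) obtain t1' t2' s2' where
    "u = 1 + atime e + t1' + t2'" "exec n LO cmp c s1 t1' s2'" "exec n LO cmp (While e c) s2' t2' s''"
    by (cases rule: exec_WhileE) auto
  then show ?case using WhileTrue.IH(1)[of t1' s2'] WhileTrue.IH(2)[of t2' s''] by simp
next
  case LinOpt
  then show ?case by (rule exec_LinOptE) simp
next
  case Compare
  then show ?case by (rule exec_CompareE) simp
qed

text \<open>Register 0 initially holds \<open>n\<close> and array 0 the weights \<open>w\<close>; everything else is 0, so no further
  information on the instance is available except through the oracles. The output is read off
  array 1.\<close>

definition initial_state :: "nat \<Rightarrow> int vec \<Rightarrow> state" where
  "initial_state n w =
     \<lparr>regs = (\<lambda>_. 0)(0 := int n), arrs = (\<lambda>_ _. 0)(0 := write_vec n w (\<lambda>_. 0))\<rparr>"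

definition result_vec :: "nat \<Rightarrow> state \<Rightarrow> int vec" where
  "result_vec n s = vec_of_array n (arrs s 1)"

end

theory Submission
  imports Defs
begin

text \<open>Fix a large constant \<open>K\<close>. With respect to a feasible \<open>y\<close>, call a weight \<^emph>\<open>light\<close> if \<open>y\<close> uses
  fewer than \<open>K\<close> elements of that weight, and \<^emph>\<open>heavy\<close> otherwise. Let \<open>T\<close> consist of all light elements
  of \<open>y\<close> and of \<open>K\<close> elements of every heavy weight. As \<open>T\<close> has at most \<open>K * p\<close> elements, an algorithm
  can afford to guess it by trying all possibilities, and likewise the set of heavy weights. For the
  right guess, query the oracle with the objective that pays for each element of \<open>T\<close> a bonus
  exceeding the total weight, for every other element of a heavy weight its weight, and \<open>-1\<close> for
  everything else. The answer \<open>x\<close> then contains \<open>T\<close>, has exactly as many elements of each light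
  weight as \<open>y\<close>, has at least \<open>K\<close> elements of each heavy weight, and satisfies \<open>wx \<ge> wy\<close>
  (\<open>objective_maximizer\<close>, \<open>dominating_query\<close>). Every subset of \<open>x\<close> is feasible, and only \<open>n + 1\<close>
  choices per weight have to be tried to see all values that such subsets attain.\<close>

text \<open>When is the value \<open>wy\<close> not among these? The light weights contribute the same to \<open>x\<close> and \<open>y\<close>. So what
  is left is a number \<open>u\<close> that is a sum of heavy weights and is at most the heavy part of \<open>wx\<close>,
  but cannot be written as such a sum with the multiplicities bounded by those of \<open>x\<close>, which are
  all at least \<open>K\<close>. Call this a \<^emph>\<open>gap\<close>. Three arithmetic facts control gaps once \<open>K\<close> is large enough:
  their number is bounded by a constant (\<open>gaps_bounded\<close>), since they only occur near the two ends of
  the range; there is none if the heavy weights form a divisibility chain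
  (\<open>gaps_divisibility_chain\<close>); and for two coprime weights the distance of a gap from the top of
  the range is a number that the two weights do not represent, so that the number of gaps is at most
  the Frobenius number (\<open>card_gaps_two\<close>).\<close>

text \<open>The counts of \<open>y\<close>, capped at \<open>K\<close>, form its signature. Among the answers that belong to one signature,
  the one of largest weight serves all \<open>y\<close> of that signature, so the missed values with this
  signature are gaps for a single vector of multiplicities (\<open>missed_values_in_gaps\<close>). There are at
  most \<open>(K + 1) ^ p\<close> signatures, which yields the constant \<open>r\<close>. For \<open>p = 2\<close> a signature with a light
  weight has at most one heavy weight, hence no gaps; thus only the signature with both weights
  heavy counts, and \<open>r\<close> can be taken to be the Frobenius number itself.\<close>

text \<open>The program is a nest of loops, constantly many and each with at most \<open>n + 1\<close> rounds. Hence a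
  polynomial time bound can be computed from the program text alone (\<open>time_poly\<close>), and verifying the
  program amounts to exhibiting loop invariants.\<close>

section \<open>Which sums of weights cannot be reached with bounded multiplicities\<close>

text \<open>The numerical semigroup generated by \<open>A\<close>, cut off at the largest value attainable with
  multiplicities at most \<open>l\<close>, without the values attained in this way. Apart from a constant shift,
  the values that the search misses are of this kind.\<close>

definition gaps :: "nat set \<Rightarrow> (nat \<Rightarrow> nat) \<Rightarrow> nat set" where
  "gaps A l = {v. (\<exists>c. v = (\<Sum>\<alpha>\<in>A. c \<alpha> * \<alpha>)) \<and> v \<le> (\<Sum>\<alpha>\<in>A. l \<alpha> * \<alpha>) \<and>
                  \<not> (\<exists>c. (\<forall>\<alpha>\<in>A. c \<alpha> \<le> l \<alpha>) \<and> v = (\<Sum>\<alpha>\<in>A. c \<alpha> * \<alpha>))}"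

lemma sum_weighted_upd_add:
  fixes z :: "'a \<Rightarrow> nat"
  assumes "finite A" "b \<in> A"
  shows "(\<Sum>\<alpha>\<in>A. (z(b := z b + t)) \<alpha> * g \<alpha>) = (\<Sum>\<alpha>\<in>A. z \<alpha> * g \<alpha>) + t * g b"
proof -
  have "(\<Sum>\<alpha>\<in>A - {b}. (z(b := z b + t)) \<alpha> * g \<alpha>) = (\<Sum>\<alpha>\<in>A - {b}. z \<alpha> * g \<alpha>)"
    by (rule sum.cong) auto
  then show ?thesis
    using sum.remove[OF assms, of "\<lambda>\<alpha>. (z(b := z b + t)) \<alpha> * g \<alpha>"] sum.remove[OF assms, of "\<lambda>\<alpha>. z \<alpha> * g \<alpha>"]
    by (simp add: algebra_simps)
qed

lemma obtain_maximizer: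
  fixes f :: "'a \<Rightarrow> nat"
  assumes "P k" "\<And>y. P y \<Longrightarrow> f y \<le> b"
  obtains x where "P x" "\<And>y. P y \<Longrightarrow> f y \<le> f x"
  using ex_has_greatest_nat[of P k f "Suc b"] assms by (auto simp: less_Suc_eq_le)

text \<open>Away from both ends of the range there are no gaps. A walk by single steps from multiplicities \<open>B\<close>
  to multiplicities \<open>l - B\<close> comes within \<open>\<Sum>A\<close> of the target \<open>v\<close>. The remaining difference is one
  of finitely many integer combinations of \<open>A\<close>, and \<open>B\<close> bounds the coefficients of fixed
  representations of all these, so adding the coefficients stays within \<open>0\<close> and \<open>l\<close>. Instead of
  walking, the proof takes the largest sum not exceeding \<open>v\<close> over the inner box.\<close>

lemma gaps_bounded:
  assumes fin: "finite A" and pos: "\<And>\<alpha>. \<alpha> \<in> A \<Longrightarrow> 0 < \<alpha>"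
  shows "\<exists>K R. \<forall>l. (\<forall>\<alpha>\<in>A. K \<le> l \<alpha>) \<longrightarrow> card (gaps A l) \<le> R"
proof -
  define D where "D = {d :: int. 0 \<le> d \<and> d \<le> int (\<Sum>A) \<and> (\<exists>b. d = (\<Sum>\<alpha>\<in>A. b \<alpha> * int \<alpha>))}"
  have finD: "finite D"
    by (rule finite_subset[of _ "{0..int (\<Sum>A)}"]) (auto simp: D_def)
  obtain b where b: "\<And>d. d \<in> D \<Longrightarrow> d = (\<Sum>\<alpha>\<in>A. b d \<alpha> * int \<alpha>)"
    using bchoice[of D "\<lambda>d b. d = (\<Sum>\<alpha>\<in>A. b \<alpha> * int \<alpha>)"] unfolding D_def by blast
  define B where "B = (\<Sum>d\<in>D. \<Sum>\<alpha>\<in>A. nat \<bar>b d \<alpha>\<bar>)"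
  have bB: "\<bar>b d \<alpha>\<bar> \<le> int B" if "d \<in> D" "\<alpha> \<in> A" for d \<alpha>
  proof -
    have "nat \<bar>b d \<alpha>\<bar> \<le> (\<Sum>\<alpha>\<in>A. nat \<bar>b d \<alpha>\<bar>)"
      using that fin by (intro member_le_sum) auto
    also have "\<dots> \<le> B"
      unfolding B_def using that finD by (intro member_le_sum[where f = "\<lambda>d. \<Sum>\<alpha>\<in>A. nat \<bar>b d \<alpha>\<bar>"]) auto
    finally show ?thesis by linarith
  qed
  define N where "N = B * \<Sum>A"
  have "card (gaps A l) \<le> 2 * N" if l: "\<forall>\<alpha>\<in>A. 2 * B \<le> l \<alpha>" for l
  proof -
    define m where "m = (\<Sum>\<alpha>\<in>A. l \<alpha> * \<alpha>)"
    have mid: "\<exists>c. (\<forall>\<alpha>\<in>A. c \<alpha> \<le> l \<alpha>) \<and> v = (\<Sum>\<alpha>\<in>A. c \<alpha> * \<alpha>)"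
      if v: "N \<le> v" "v + N \<le> m" "v = (\<Sum>\<alpha>\<in>A. c0 \<alpha> * \<alpha>)" for v c0
    proof -
      let ?P = "\<lambda>z. (\<forall>\<alpha>\<in>A. B \<le> z \<alpha> \<and> z \<alpha> + B \<le> l \<alpha>) \<and> (\<Sum>\<alpha>\<in>A. z \<alpha> * \<alpha>) \<le> v"
      have base: "?P (\<lambda>_. B)"
        using l v(1) by (force simp: N_def sum_distrib_left)
      obtain z where z: "?P z" and zmax: "\<And>y. ?P y \<Longrightarrow> (\<Sum>\<alpha>\<in>A. y \<alpha> * \<alpha>) \<le> (\<Sum>\<alpha>\<in>A. z \<alpha> * \<alpha>)"
        by (rule obtain_maximizer[of ?P, OF base, of "\<lambda>z. \<Sum>\<alpha>\<in>A. z \<alpha> * \<alpha>" v]) blast+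
      let ?zv = "\<Sum>\<alpha>\<in>A. z \<alpha> * \<alpha>"
      have close: "v \<le> ?zv + \<Sum>A"
      proof (cases "\<exists>\<alpha>\<in>A. z \<alpha> + B < l \<alpha>")
        case True
        then obtain \<alpha> where \<alpha>: "\<alpha> \<in> A" "z \<alpha> + B < l \<alpha>" by blast
        have up: "(\<Sum>\<beta>\<in>A. (z(\<alpha> := z \<alpha> + 1)) \<beta> * \<beta>) = ?zv + \<alpha>"
          using sum_weighted_upd_add[OF fin \<alpha>(1), of z 1 "\<lambda>x. x"] by simp
        have "\<not> ?P (z(\<alpha> := z \<alpha> + 1))"
          using zmax[of "z(\<alpha> := z \<alpha> + 1)"] up pos[OF \<alpha>(1)] by linarith
        then have "v < ?zv + \<alpha>" using z \<alpha> up by (auto split: if_splits)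
        moreover have "\<alpha> \<le> \<Sum>A" using \<alpha>(1) fin by (intro member_le_sum[where f = "\<lambda>x. x"]) auto
        ultimately show ?thesis by linarith
      next
        case False
        then have "l \<alpha> = z \<alpha> + B" if "\<alpha> \<in> A" for \<alpha> using z that by force
        then have "m = (\<Sum>\<alpha>\<in>A. (z \<alpha> + B) * \<alpha>)" unfolding m_def by (intro sum.cong) auto
        also have "\<dots> = ?zv + N" by (simp add: N_def sum_distrib_left sum.distrib algebra_simps)
        finally show ?thesis using v(2) by linarith
      qed
      define d where "d = int v - int ?zv"
      have "d = (\<Sum>\<alpha>\<in>A. (int (c0 \<alpha>) - int (z \<alpha>)) * int \<alpha>)"
        by (simp add: d_def v(3) sum_subtractf algebra_simps)
      then have "\<exists>b. d = (\<Sum>\<alpha>\<in>A. b \<alpha> * int \<alpha>)"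
        by (rule exI[of _ "\<lambda>\<alpha>. int (c0 \<alpha>) - int (z \<alpha>)"])
      moreover have "0 \<le> d" "d \<le> int (\<Sum>A)" using z close by (auto simp: d_def simp del: of_nat_sum)
      ultimately have d: "d \<in> D" unfolding D_def by blast
      let ?c = "\<lambda>\<alpha>. nat (int (z \<alpha>) + b d \<alpha>)"
      have c: "int (?c \<alpha>) = int (z \<alpha>) + b d \<alpha> \<and> ?c \<alpha> \<le> l \<alpha>" if "\<alpha> \<in> A" for \<alpha>
        using bB[OF d that] z that by force
      have "int v = int ?zv + d" by (simp add: d_def)
      also have "\<dots> = (\<Sum>\<alpha>\<in>A. (int (z \<alpha>) + b d \<alpha>) * int \<alpha>)"
        by (subst b[OF d]) (simp add: sum.distrib algebra_simps)
      also have "\<dots> = int (\<Sum>\<alpha>\<in>A. ?c \<alpha> * \<alpha>)" using c by (simp del: int_nat_eq)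
      finally have "v = (\<Sum>\<alpha>\<in>A. ?c \<alpha> * \<alpha>)" by (simp only: of_nat_eq_iff)
      then show ?thesis using c by (intro exI[of _ ?c]) blast
    qed
    have "gaps A l \<subseteq> {..<N} \<union> {m - N<..m}"
    proof
      fix v assume "v \<in> gaps A l"
      then have "\<not> (N \<le> v \<and> v + N \<le> m)" "v \<le> m" using mid unfolding gaps_def m_def by blast+
      then show "v \<in> {..<N} \<union> {m - N<..m}" by auto
    qed
    then have "card (gaps A l) \<le> card ({..<N} \<union> {m - N<..m})" by (intro card_mono) auto
    also have "\<dots> \<le> card {..<N} + card {m - N<..m}" by (rule card_Un_le)
    also have "\<dots> \<le> 2 * N" by simp
    finally show ?thesis .
  qed
  then show ?thesis by blast
qed

text \<open>Peel off the largest weight \<open>b\<close>, using it as often as possible. If the rest still exceeded what the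
  smaller weights can provide, some smaller weight \<open>\<alpha>\<close> would occur more than \<open>b\<close> times, and \<open>b / \<alpha>\<close>
  copies of it could be traded for one more \<open>b\<close>. Conversely, surplus copies of \<open>b\<close> are traded for
  copies of any smaller weight.\<close>

lemma gaps_divisibility_chain:
  assumes "finite A" "\<And>\<alpha>. \<alpha> \<in> A \<Longrightarrow> 0 < \<alpha>"
    and "\<And>\<alpha> \<beta>. \<alpha> \<in> A \<Longrightarrow> \<beta> \<in> A \<Longrightarrow> \<alpha> dvd \<beta> \<or> \<beta> dvd \<alpha>"
    and "\<And>\<alpha> \<beta>. \<alpha> \<in> A \<Longrightarrow> \<beta> \<in> A \<Longrightarrow> \<beta> \<le> l \<alpha>"
  shows "gaps A l = {}"
  using assms
proof (induction A rule: finite_linorder_max_induct)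
  case empty
  then show ?case by (auto simp: gaps_def)
next
  case (insert b A)
  have b: "b \<notin> A" "b > 0" using insert.hyps insert.prems by auto
  have IH: "gaps A l = {}" using insert by simp
  have dvd: "\<alpha> dvd b" if "\<alpha> \<in> A" for \<alpha>
    using insert.prems(2)[of \<alpha> b] insert.hyps(2) that dvd_imp_le[of b \<alpha>] insert.prems(1)[of \<alpha>] by force
  have "\<exists>c. (\<forall>\<alpha>\<in>insert b A. c \<alpha> \<le> l \<alpha>) \<and> v = (\<Sum>\<alpha>\<in>insert b A. c \<alpha> * \<alpha>)"
    if v: "v = (\<Sum>\<alpha>\<in>insert b A. c \<alpha> * \<alpha>)" "v \<le> (\<Sum>\<alpha>\<in>insert b A. l \<alpha> * \<alpha>)" for v c
  proof -
    let ?P = "\<lambda>c. c b \<le> l b \<and> v = (\<Sum>\<alpha>\<in>insert b A. c \<alpha> * \<alpha>)"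
    obtain c where c: "?P c"
    proof (cases "c b \<le> l b")
      case True
      then show ?thesis using v that by blast
    next
      case False
      have "A \<noteq> {}" using False v b by auto
      then obtain \<alpha> where \<alpha>: "\<alpha> \<in> A" by blast
      obtain k where k: "b = \<alpha> * k" using dvd[OF \<alpha>] by (rule dvdE)
      let ?c = "c(\<alpha> := c \<alpha> + (c b - l b) * k)"
      let ?c' = "?c(b := l b)"
      have "(\<Sum>\<beta>\<in>A. ?c' \<beta> * \<beta>) = (\<Sum>\<beta>\<in>A. ?c \<beta> * \<beta>)" using b by (intro sum.cong) auto
      also have "\<dots> = (\<Sum>\<beta>\<in>A. c \<beta> * \<beta>) + (c b - l b) * k * \<alpha>"
        using sum_weighted_upd_add[OF insert.hyps(1) \<alpha>, of c "(c b - l b) * k" "\<lambda>x. x"] by simp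
      also have "(c b - l b) * k * \<alpha> = (c b - l b) * b" using k by simp
      finally have "(\<Sum>\<beta>\<in>A. ?c' \<beta> * \<beta>) = (\<Sum>\<beta>\<in>A. c \<beta> * \<beta>) + (c b - l b) * b" .
      moreover have "l b * b + (c b - l b) * b = c b * b" using False
        by (metis add_diff_inverse_nat distrib_right nat_le_linear not_less)
      ultimately have "?P ?c'" using v b insert.hyps(1) by simp
      then show ?thesis by (rule that)
    qed
    \<comment> \<open>The largest weight occurs as often as its bound and the value \<open>v\<close> permit.\<close>
    then obtain c where c: "?P c" and cmax: "\<And>c'. ?P c' \<Longrightarrow> c' b \<le> c b"
      by (rule obtain_maximizer[of ?P _ "\<lambda>c. c b" "l b"]) blast+
    let ?u = "\<Sum>\<alpha>\<in>A. c \<alpha> * \<alpha>"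
    have vu: "v = c b * b + ?u" using c b insert.hyps(1) by simp
    have "?u \<le> (\<Sum>\<alpha>\<in>A. l \<alpha> * \<alpha>)"
    proof (rule ccontr)
      assume big: "\<not> ?thesis"
      moreover have "c b * b + ?u \<le> l b * b + (\<Sum>\<alpha>\<in>A. l \<alpha> * \<alpha>)"
        using v(2) vu b insert.hyps(1) by simp
      ultimately have "c b * b < l b * b" by linarith
      then have cb: "c b < l b" using b by simp
      obtain \<alpha> where \<alpha>: "\<alpha> \<in> A" "l \<alpha> < c \<alpha>"
        using big sum_mono[of A "\<lambda>\<alpha>. c \<alpha> * \<alpha>" "\<lambda>\<alpha>. l \<alpha> * \<alpha>"] by (meson mult_le_mono1 not_less)
      obtain k where k: "b = \<alpha> * k" using dvd[OF \<alpha>(1)] by (rule dvdE)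
      have "k \<le> b" using k b by simp
      then have kc: "k \<le> c \<alpha>" using insert.prems(3)[of \<alpha> b] \<alpha> by simp
      let ?d = "c(\<alpha> := c \<alpha> - k)"
      let ?c' = "?d(b := c b + 1)"
      have "?u = (\<Sum>\<beta>\<in>A. (?d(\<alpha> := ?d \<alpha> + k)) \<beta> * \<beta>)" using kc by (intro sum.cong) auto
      also have "\<dots> = (\<Sum>\<beta>\<in>A. ?d \<beta> * \<beta>) + k * \<alpha>"
        by (rule sum_weighted_upd_add[OF insert.hyps(1) \<alpha>(1)])
      also have "(\<Sum>\<beta>\<in>A. ?d \<beta> * \<beta>) = (\<Sum>\<beta>\<in>A. ?c' \<beta> * \<beta>)" using b by (intro sum.cong) auto
      finally have "?u = (\<Sum>\<beta>\<in>A. ?c' \<beta> * \<beta>) + b" using k by (simp add: mult.commute)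
      then have "?P ?c'" using vu cb b insert.hyps(1) by simp
      from cmax[OF this] show False by simp
    qed
    then obtain c' where c': "\<forall>\<alpha>\<in>A. c' \<alpha> \<le> l \<alpha>" "?u = (\<Sum>\<alpha>\<in>A. c' \<alpha> * \<alpha>)"
      using IH unfolding gaps_def by blast
    have "(\<Sum>\<alpha>\<in>A. (c'(b := c b)) \<alpha> * \<alpha>) = (\<Sum>\<alpha>\<in>A. c' \<alpha> * \<alpha>)"
      using b by (intro sum.cong) auto
    then show ?thesis
      using c' vu c b insert.hyps(1) by (intro exI[of _ "c'(b := c b)"]) auto
  qed
  then show ?case unfolding gaps_def by blast
qed

text \<open>Take the representation \<open>v = i * a + j * b\<close> with \<open>i \<le> l a\<close> and \<open>i\<close> as large as possible. As \<open>v\<close> is a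
  gap, \<open>j > l b \<ge> a\<close>, and maximality gives \<open>l a < i + b\<close> because \<open>a\<close> copies of \<open>b\<close> could be traded
  for \<open>b\<close> copies of \<open>a\<close>. So \<open>m - v = (l a - i) * a + (l b - j) * b\<close> with a first coefficient in
  \<open>{0..<b}\<close> and a negative second one; all other representations differ by multiples of \<open>(b, -a)\<close>,
  hence none of them is nonnegative.\<close>

lemma gaps_two:
  assumes cop: "coprime a b" and pos: "0 < a" "0 < b" "a \<noteq> b" and l: "b \<le> l a" "a \<le> l b"
  defines "m \<equiv> l a * a + l b * b"
  assumes v: "v \<in> gaps {a, b} l"
  shows "v \<le> m" "\<nexists>i j. m - v = i * a + j * b"
proof -
  have two: "(\<Sum>\<alpha>\<in>{a, b}. c \<alpha> * \<alpha>) = c a * a + c b * b" for c :: "nat \<Rightarrow> nat"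
    using pos by simp
  show vm: "v \<le> m" using v pos by (simp add: gaps_def two m_def)
  let ?P = "\<lambda>(i, j). i \<le> l a \<and> v = i * a + j * b"
  obtain i j where ij: "v = i * a + j * b" using v unfolding gaps_def two by blast
  \<comment> \<open>Some representation has its first coefficient below \<open>b\<close>, hence at most \<open>l a\<close>.\<close>
  have "i * a + j * b = (i mod b) * a + (j + (i div b) * a) * b"
  proof -
    have "i * a = (i mod b + i div b * b) * a" by simp
    then show ?thesis by (simp only: algebra_simps)
  qed
  moreover have "i mod b \<le> l a" using l pos by (meson le_trans mod_less_divisor less_imp_le)
  ultimately have "?P (i mod b, j + (i div b) * a)" using ij by simp
  then obtain p where "?P p" and pmax: "\<And>p'. ?P p' \<Longrightarrow> fst p' \<le> fst p"
    by (rule obtain_maximizer[of ?P _ fst "l a"]) auto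
  then obtain i j where P: "i \<le> l a" "v = i * a + j * b"
    and max: "\<And>i' j'. i' \<le> l a \<Longrightarrow> v = i' * a + j' * b \<Longrightarrow> i' \<le> i"
    by (cases p) fastforce
  have j: "l b < j"
  proof (rule ccontr)
    assume "\<not> ?thesis"
    then have "(\<forall>\<alpha>\<in>{a, b}. ((\<lambda>_. 0)(a := i, b := j)) \<alpha> \<le> l \<alpha>) \<and> v = (\<Sum>\<alpha>\<in>{a, b}. ((\<lambda>_. 0)(a := i, b := j)) \<alpha> * \<alpha>)"
      using P pos by (simp add: two)
    then show False using v unfolding gaps_def by blast
  qed
  then obtain j' where j': "j = j' + a" using l by (metis le_add_diff_inverse2 le_trans less_imp_le)
  have i: "l a < i + b"
  proof (rule ccontr)
    assume "\<not> ?thesis"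
    then have "i + b \<le> i" using max[of "i + b" j'] P(2) j' by (simp add: algebra_simps)
    then show False using pos by simp
  qed
  show "\<nexists>i j. m - v = i * a + j * b"
  proof
    assume "\<exists>i j. m - v = i * a + j * b"
    then obtain i' j' where "m = v + i' * a + j' * b" using vm by (metis add.assoc le_add_diff_inverse)
    then have eq: "(int (l a) - int i - int i') * int a = (int j' + int j - int (l b)) * int b"
      using P(2) unfolding m_def by (simp add: algebra_simps flip: of_nat_add of_nat_mult)
    have "0 < (int j' + int j - int (l b)) * int b" using j pos by simp
    then have p: "0 < int (l a) - int i - int i'" using eq pos by (metis of_nat_0_less_iff zero_less_mult_pos2)
    have "int b dvd (int (l a) - int i - int i') * int a" using eq by simp
    then have "int b dvd int (l a) - int i - int i'"
      using cop by (metis coprime_commute coprime_dvd_mult_left_iff coprime_int_iff)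
    then have "int b \<le> int (l a) - int i - int i'" using p by (simp add: zdvd_imp_le)
    then show False using i by linarith
  qed
qed

text \<open>The point is that the greatest non-representable integer exists: every integer from \<open>a * b\<close> on is
  representable, by reducing the first Bezout coefficient modulo \<open>b\<close>.\<close>

lemma frobenius_upper_bound:
  fixes a b :: nat
  assumes cop: "coprime a b" and pos: "2 \<le> a" "2 \<le> b"
    and g: "\<nexists>i j. g = i * a + j * b"
  shows "g \<le> frobenius [a, b]"
proof -
  let ?R = "\<lambda>m :: int. \<exists>c :: nat \<Rightarrow> nat. m = (\<Sum>i < length [a, b]. int (c i) * int ([a, b] ! i))"
  have R: "?R m \<longleftrightarrow> (\<exists>i j. m = int (i * a + j * b))" for m
  proof
    assume "\<exists>i j. m = int (i * a + j * b)"
    then obtain i j where "m = int (i * a + j * b)" by blast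
    then show "?R m" by (intro exI[of _ "\<lambda>k. if k = 0 then i else j"]) (simp add: numeral_2_eq_2)
  next
    assume "?R m"
    then obtain c where "m = (\<Sum>i < length [a, b]. int (c i) * int ([a, b] ! i))" by blast
    then show "\<exists>i j. m = int (i * a + j * b)"
      by (intro exI[of _ "c 0"] exI[of _ "c 1"]) (simp add: numeral_2_eq_2)
  qed
  have large: "?R m" if m: "m \<ge> int (a * b)" for m
  proof -
    obtain x y where xy: "x * int a + y * int b = gcd (int a) (int b)" using bezout_int by blast
    then have m_eq: "m = m * x * int a + m * y * int b"
      using cop by (simp add: algebra_simps flip: distrib_left)
    define i where "i = (m * x) mod int b"
    define j where "j = (m * x) div int b * int a + m * y"
    have "m * x = i + (m * x) div int b * int b" by (simp add: i_def)
    then have "m * x * int a = (i + (m * x) div int b * int b) * int a" by (rule arg_cong)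
    then have ij: "m = i * int a + j * int b"
      by (subst m_eq) (simp add: j_def algebra_simps)
    have i: "0 \<le> i" "i < int b" using pos by (auto simp: i_def)
    have "i * int a < int a * int b" using i pos by (simp add: mult.commute)
    then have "0 < j * int b" using ij m by simp
    then have "0 < j" using pos by (simp add: zero_less_mult_iff)
    then have "m = int (nat i * a + nat j * b)" using ij i by simp
    then show ?thesis unfolding R by blast
  qed
  have notg: "\<not> ?R (int g)" using g unfolding R by (metis of_nat_eq_iff)
  have bound: "m \<le> int (a * b)" if "\<not> ?R m" for m using large[of m] that by (meson linear)
  let ?G = "{m \<in> {0..int (a * b)}. \<not> ?R m}"
  have finG: "finite ?G" by (rule finite_subset[of _ "{0..int (a * b)}"]) auto
  define M where "M = Max ?G"
  have gM: "int g \<in> ?G" using notg bound by simp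
  then have "M \<in> ?G" unfolding M_def by (intro Max_in finG) blast
  moreover have le: "m \<le> M" if "\<not> ?R m" for m
  proof (cases "0 \<le> m")
    case True
    then show ?thesis unfolding M_def using that bound by (intro Max_ge finG) auto
  next
    case False
    moreover have "int g \<le> M" unfolding M_def using gM by (intro Max_ge finG)
    ultimately show ?thesis by linarith
  qed
  ultimately have "(GREATEST m. \<not> ?R m) = M" by (intro Greatest_equality) auto
  then have "int g \<le> (GREATEST m. \<not> ?R m)" using le notg by simp
  then show ?thesis using pos unfolding frobenius_def by auto
qed

lemma finite_gaps: "finite (gaps A l)"
  by (rule finite_subset[of _ "{..\<Sum>\<alpha>\<in>A. l \<alpha> * \<alpha>}"]) (auto simp: gaps_def)

lemma gaps_uniformly_bounded:
  assumes "finite A" "\<And>\<alpha>. \<alpha> \<in> A \<Longrightarrow> 0 < (\<alpha> :: nat)"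
  obtains K R where "\<And>L l. L \<subseteq> A \<Longrightarrow> (\<forall>\<alpha>\<in>L. K \<le> l \<alpha>) \<Longrightarrow> card (gaps L l) \<le> R"
proof -
  have "\<exists>K R. \<forall>l. (\<forall>\<alpha>\<in>L. K \<le> l \<alpha>) \<longrightarrow> card (gaps L l) \<le> R" if "L \<subseteq> A" for L
    using that assms by (intro gaps_bounded) (auto intro: finite_subset)
  then obtain K R where KR: "\<And>L l. L \<subseteq> A \<Longrightarrow> (\<forall>\<alpha>\<in>L. K L \<le> l \<alpha>) \<Longrightarrow> card (gaps L l) \<le> R L"
    by metis
  have fin: "finite (Pow A)" using assms(1) by simp
  have "card (gaps L l) \<le> Max (R ` Pow A)" if "L \<subseteq> A" "\<forall>\<alpha>\<in>L. Max (K ` Pow A) \<le> l \<alpha>" for L l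
  proof -
    have "K L \<le> Max (K ` Pow A)" "R L \<le> Max (R ` Pow A)" using that(1) fin by auto
    then show ?thesis using KR[of L l] that by (meson le_trans)
  qed
  then show thesis by (rule that)
qed

text \<open>Reflection at the top of the range maps gaps injectively to positive integers that are not
  representable, and all of these are at most the Frobenius number. If one of the weights is 1, they form a
  divisibility chain.\<close>

lemma card_gaps_two:
  assumes a: "primitive_tuple a" "length a = 2" and l: "\<And>\<alpha>. \<alpha> \<in> set a \<Longrightarrow> \<Sum>(set a) \<le> l \<alpha>"
  shows "card (gaps (set a) l) \<le> frobenius a"
proof -
  obtain p q where pq: "a = [p, q]" using a(2) by (metis length_0_conv length_Suc_conv numeral_2_eq_2)
  have ne: "p \<noteq> q" and pos: "0 < p" "0 < q" and cop: "coprime p q"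
    using a(1) unfolding pq primitive_tuple_def by (auto simp: coprime_iff_gcd_eq_1 less_Suc_eq)
  have lpq: "q \<le> l p" "p \<le> l q" "p \<le> l p" "q \<le> l q"
    using l[of p] l[of q] ne unfolding pq by auto
  show ?thesis
  proof (cases "1 \<in> set a")
    case True
    then have "gaps {p, q} l = {}"
      using pos lpq unfolding pq by (intro gaps_divisibility_chain) auto
    then show ?thesis by (simp add: pq)
  next
    case False
    then have two: "2 \<le> p" "2 \<le> q" using pos unfolding pq by auto
    let ?m = "l p * p + l q * q"
    have "inj_on (\<lambda>v. ?m - v) (gaps {p, q} l)"
      using gaps_two(1)[OF cop pos ne lpq(1,2)] by (intro inj_onI) (metis diff_diff_cancel)
    moreover have "(\<lambda>v. ?m - v) ` gaps {p, q} l \<subseteq> {1..frobenius [p, q]}"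
    proof
      fix g assume "g \<in> (\<lambda>v. ?m - v) ` gaps {p, q} l"
      then obtain v where v: "v \<in> gaps {p, q} l" "g = ?m - v" by (rule imageE)
      have g: "\<nexists>i j. g = i * p + j * q"
        using gaps_two(2)[OF cop pos ne lpq(1,2) v(1)] unfolding v(2) .
      moreover have "g \<noteq> 0" using g by (metis add_0 mult_0)
      ultimately show "g \<in> {1..frobenius [p, q]}"
        using frobenius_upper_bound[OF cop two] by auto
    qed
    ultimately have "card (gaps {p, q} l) \<le> card {1..frobenius [p, q]}"
      by (intro card_inj_on_le) auto
    then show ?thesis by (simp add: pq)
  qed
qed

section \<open>Total correctness and running time of programs\<close>

text \<open>The registers and arrays occurring as targets in a program give frame conditions for free: loop
  invariants then only need to mention what the loop changes.\<close>

primrec regs_written :: "com \<Rightarrow> nat set" where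
  "regs_written Skip = {}"
| "regs_written (Assign x e) = {x}"
| "regs_written (Store A e1 e2) = {}"
| "regs_written (Seq c1 c2) = regs_written c1 \<union> regs_written c2"
| "regs_written (Cond e c1 c2) = regs_written c1 \<union> regs_written c2"
| "regs_written (While e c) = regs_written c"
| "regs_written (LinOpt A B) = {}"
| "regs_written (Compare x e1 e2) = {x}"

primrec arrs_written :: "com \<Rightarrow> nat set" where
  "arrs_written Skip = {}"
| "arrs_written (Assign x e) = {}"
| "arrs_written (Store A e1 e2) = {A}"
| "arrs_written (Seq c1 c2) = arrs_written c1 \<union> arrs_written c2"
| "arrs_written (Cond e c1 c2) = arrs_written c1 \<union> arrs_written c2"
| "arrs_written (While e c) = arrs_written c"
| "arrs_written (LinOpt A B) = {B}"
| "arrs_written (Compare x e1 e2) = {}"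

definition unchanged :: "com \<Rightarrow> state \<Rightarrow> state \<Rightarrow> bool" where
  "unchanged c s s' \<longleftrightarrow> (\<forall>x. x \<notin> regs_written c \<longrightarrow> regs s' x = regs s x) \<and>
                       (\<forall>A. A \<notin> arrs_written c \<longrightarrow> arrs s' A = arrs s A)"

lemma exec_unchanged: "exec n LO cmp c s t s' \<Longrightarrow> unchanged c s s'"
  unfolding unchanged_def by (induction rule: exec.induct) auto

text \<open>A bound on the running time in terms of \<open>n\<close>, valid for programs all of whose loops run for at most
  \<open>n + 1\<close> rounds; the polynomials \<open>[:1, 1:]\<close> and \<open>[:2, 1:]\<close> are \<open>n + 1\<close> and \<open>n + 2\<close>, the numbers of
  rounds and of tests.\<close>

primrec time_poly :: "com \<Rightarrow> nat poly" where
  "time_poly Skip = 1"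
| "time_poly (Assign x e) = [:1 + atime e:]"
| "time_poly (Store A e1 e2) = [:1 + atime e1 + atime e2:]"
| "time_poly (Seq c1 c2) = time_poly c1 + time_poly c2"
| "time_poly (Cond e c1 c2) = [:1 + atime e:] + time_poly c1 + time_poly c2"
| "time_poly (While e c) = [:2, 1:] * [:1 + atime e:] + [:1, 1:] * time_poly c"
| "time_poly (LinOpt A B) = 1"
| "time_poly (Compare x e1 e2) = [:1 + atime e1 + atime e2:]"

locale machine =
  fixes n :: nat and LO :: "int vec \<Rightarrow> int vec" and cmp :: "int \<Rightarrow> int \<Rightarrow> bool"
begin

text \<open>The weakest precondition for total correctness within the time bound. Since the bound is determined
  by the program, the proof rules below do not mention time, except that the rule for loops limits
  the number of rounds.\<close>

definition achieves :: "com \<Rightarrow> (state \<Rightarrow> bool) \<Rightarrow> state \<Rightarrow> bool" where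
  "achieves c Q s \<longleftrightarrow> (\<exists>t s'. exec n LO cmp c s t s' \<and> t \<le> poly (time_poly c) n \<and> Q s')"

lemma achieves_mono: "achieves c Q s \<Longrightarrow> (\<And>s'. unchanged c s s' \<Longrightarrow> Q s' \<Longrightarrow> R s') \<Longrightarrow> achieves c R s"
  unfolding achieves_def using exec_unchanged by blast

lemma achieves_Skip: "Q s \<Longrightarrow> achieves Skip Q s"
  unfolding achieves_def by (intro exI conjI, rule exec.Skip) auto

lemma achieves_Assign:
  "Q (s\<lparr>regs := (regs s)(x := aval e s)\<rparr>) \<Longrightarrow> achieves (Assign x e) Q s"
  unfolding achieves_def by (intro exI conjI, rule exec.Assign) auto

lemma achieves_Store:
  "Q (s\<lparr>arrs := (arrs s)(A := (arrs s A)(aval e1 s := aval e2 s))\<rparr>) \<Longrightarrow> achieves (Store A e1 e2) Q s"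
  unfolding achieves_def by (intro exI conjI, rule exec.Store) auto

lemma achieves_LinOpt:
  "Q (s\<lparr>arrs := (arrs s)(B := write_vec n (LO (vec_of_array n (arrs s A))) (arrs s B))\<rparr>) \<Longrightarrow>
    achieves (LinOpt A B) Q s"
  unfolding achieves_def by (intro exI conjI, rule exec.LinOpt) auto

lemma achieves_Compare:
  "Q (s\<lparr>regs := (regs s)(x := (if cmp (aval e1 s) (aval e2 s) then 1 else 0))\<rparr>) \<Longrightarrow>
    achieves (Compare x e1 e2) Q s"
  unfolding achieves_def by (intro exI conjI, rule exec.Compare) auto

lemma achieves_Seq: "achieves c1 (achieves c2 Q) s \<Longrightarrow> achieves (Seq c1 c2) Q s"
  unfolding achieves_def by (force intro: exec.Seq add_mono)

lemma achieves_Cond: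
  assumes "aval e s > 0 \<Longrightarrow> achieves c1 Q s" "\<not> aval e s > 0 \<Longrightarrow> achieves c2 Q s"
  shows "achieves (Cond e c1 c2) Q s"
proof (cases "aval e s > 0")
  case True
  then obtain t s' where "exec n LO cmp c1 s t s'" "t \<le> poly (time_poly c1) n" "Q s'"
    using assms unfolding achieves_def by blast
  then show ?thesis unfolding achieves_def
    by (intro exI conjI) (rule exec.CondTrue[OF True], auto)
next
  case False
  then obtain t s' where "exec n LO cmp c2 s t s'" "t \<le> poly (time_poly c2) n" "Q s'"
    using assms unfolding achieves_def by blast
  then show ?thesis unfolding achieves_def
    by (intro exI conjI) (rule exec.CondFalse[OF False], auto)
qed

text \<open>The invariant is indexed by the number of completed rounds, and the number \<open>N\<close> of rounds is known in advance.
  The frame condition of the whole loop is available in every round.\<close>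

lemma achieves_While:
  fixes I :: "nat \<Rightarrow> state \<Rightarrow> bool"
  assumes N: "N \<le> n + 1" and init: "I 0 s"
    and step: "\<And>k s'. k < N \<Longrightarrow> unchanged c s s' \<Longrightarrow> I k s' \<Longrightarrow> aval e s' > 0 \<and> achieves c (I (Suc k)) s'"
    and final: "\<And>s'. unchanged c s s' \<Longrightarrow> I N s' \<Longrightarrow> \<not> aval e s' > 0 \<and> Q s'"
  shows "achieves (While e c) Q s"
proof -
  let ?T = "poly (time_poly c) n"
  have *: "\<exists>t s''. exec n LO cmp (While e c) s' t s'' \<and>
        t \<le> Suc (N - k) * (1 + atime e) + (N - k) * ?T \<and> Q s''"
    if "k \<le> N" "unchanged c s s'" "I k s'" for k s'
    using that
  proof (induction "N - k" arbitrary: k s')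
    case 0
    then have "I N s'" by simp
    then show ?case using final[OF 0(3)] exec.WhileFalse[of e s' n LO cmp c] 0 by force
  next
    case (Suc d)
    then have k: "k < N" by simp
    then obtain t1 s1 where s1: "aval e s' > 0" "exec n LO cmp c s' t1 s1" "t1 \<le> ?T" "I (Suc k) s1"
      using step[OF k] Suc.prems unfolding achieves_def by blast
    have "unchanged c s s1"
      using Suc.prems(2) exec_unchanged[OF s1(2)] by (auto simp: unchanged_def)
    moreover have "d = N - Suc k" "Suc k \<le> N" using Suc.hyps(2) k by simp_all
    ultimately obtain t2 s2 where s2: "exec n LO cmp (While e c) s1 t2 s2"
        "t2 \<le> Suc (N - Suc k) * (1 + atime e) + (N - Suc k) * ?T" "Q s2"
      using Suc.hyps(1)[of "Suc k" s1] s1(4) by blast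
    have "N - k = Suc (N - Suc k)" using k by simp
    then have "1 + atime e + t1 + t2 \<le> Suc (N - k) * (1 + atime e) + (N - k) * ?T"
      using s1(3) s2(2) by (simp add: algebra_simps)
    then show ?case using exec.WhileTrue[OF s1(1,2) s2(1)] s2(3) by blast
  qed
  have "unchanged c s s" by (simp add: unchanged_def)
  then obtain t s'' where t: "exec n LO cmp (While e c) s t s''" "t \<le> Suc N * (1 + atime e) + N * ?T" "Q s''"
    using *[of 0 s] init by auto
  have "Suc N * (1 + atime e) + N * ?T \<le> (n + 2) * (1 + atime e) + (n + 1) * ?T"
    using N by (intro add_mono mult_le_mono1) auto
  also have "\<dots> = poly (time_poly (While e c)) n" by (simp add: algebra_simps)
  finally show ?thesis unfolding achieves_def using t by (meson le_trans)
qed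

end

section \<open>The search algorithm\<close>

text \<open>The bonus for the elements of \<open>T\<close> exceeds the total weight. The mask \<open>M\<close> is positive on the weights
  regarded as heavy; the negative entry keeps other elements out of an optimal solution.\<close>

definition objective :: "int vec \<Rightarrow> int set \<Rightarrow> (int \<Rightarrow> int) \<Rightarrow> int vec" where
  "objective w T M = vec (dim_vec w) (\<lambda>j.
     if int j \<in> T then 1 + (\<Sum>i<dim_vec w. w $ i) else if M (w $ j) > 0 then w $ j else -1)"

text \<open>Of each weight \<open>\<beta>\<close>, the first \<open>C \<beta>\<close> elements of \<open>x\<close> are kept. Counting the predecessors of equal
  weight matches a program that passes through \<open>x\<close> once and counts down \<open>C\<close>.\<close>

definition thin_out :: "int vec \<Rightarrow> int vec \<Rightarrow> (int \<Rightarrow> int) \<Rightarrow> int vec" where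
  "thin_out w x C = vec (dim_vec w) (\<lambda>j.
     if x $ j = 1 \<and> int (card {i. i < j \<and> x $ i = 1 \<and> w $ i = w $ j}) < C (w $ j) then 1 else 0)"

text \<open>Register 1 is the loop index of all inner loops, register 5 accumulates the bonus, and registers 2
  and 3 hold the weights of the current candidate and of the best solution so far. Array 2 is the
  objective, array 3 the answer of the oracle, array 5 the candidate, and array 1 the best solution.
  The guesses are stored in array 4 (numbers of elements to keep, indexed by weight), array 6 (mask,
  indexed by weight) and array 7 (indices in \<open>T\<close>); array 8 is a copy of array 4 that is counted
  down.\<close>

definition build_objective :: com where
  "build_objective =
    Seq (Assign 1 (Const 0)) (Seq (Assign 5 (Const 1))
      (While (Minus (Reg 0) (Reg 1))
        (Seq (Assign 5 (Plus (Reg 5) (Arr 0 (Reg 1))))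
        (Seq (Cond (Arr 6 (Arr 0 (Reg 1))) (Store 2 (Reg 1) (Arr 0 (Reg 1))) (Store 2 (Reg 1) (Const (-1))))
        (Seq (Store 8 (Arr 0 (Reg 1)) (Arr 4 (Arr 0 (Reg 1))))
             (Assign 1 (Plus (Reg 1) (Const 1))))))))"

primrec force_indices :: "nat \<Rightarrow> com" where
  "force_indices 0 = Skip"
| "force_indices (Suc i) = Seq (force_indices i) (Store 2 (Arr 7 (Const (int i))) (Reg 5))"

definition build_candidate :: com where
  "build_candidate =
    Seq (Assign 1 (Const 0)) (Seq (Assign 2 (Const 0))
      (While (Minus (Reg 0) (Reg 1))
        (Seq (Cond (Arr 3 (Reg 1))
               (Seq (Cond (Arr 8 (Arr 0 (Reg 1)))
                      (Seq (Store 5 (Reg 1) (Const 1)) (Assign 2 (Plus (Reg 2) (Arr 0 (Reg 1)))))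
                      (Store 5 (Reg 1) (Const 0)))
                    (Store 8 (Arr 0 (Reg 1)) (Minus (Arr 8 (Arr 0 (Reg 1))) (Const 1))))
               (Store 5 (Reg 1) (Const 0)))
             (Assign 1 (Plus (Reg 1) (Const 1))))))"

definition keep_better :: com where
  "keep_better =
    Seq (Compare 4 (Reg 3) (Reg 2))
      (Cond (Reg 4) Skip
        (Seq (Assign 3 (Reg 2)) (Seq (Assign 1 (Const 0))
          (While (Minus (Reg 0) (Reg 1))
            (Seq (Store 1 (Reg 1) (Arr 5 (Reg 1))) (Assign 1 (Plus (Reg 1) (Const 1))))))))"

definition try_parameters :: "nat \<Rightarrow> com" where
  "try_parameters k =
    Seq build_objective (Seq (force_indices k) (Seq (LinOpt 2 3) (Seq build_candidate keep_better)))"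

text \<open>Runs \<open>c\<close> for all ways to fill the given array cells with numbers from \<open>0\<close> to \<open>n\<close>. The cells
  themselves are the loop variables.\<close>

fun for_all_cells :: "(nat \<times> int) list \<Rightarrow> com \<Rightarrow> com" where
  "for_all_cells [] c = c"
| "for_all_cells ((A, i) # cells) c =
    Seq (Store A (Const i) (Const 0))
      (While (Minus (Plus (Reg 0) (Const 1)) (Arr A (Const i)))
        (Seq (for_all_cells cells c) (Store A (Const i) (Plus (Arr A (Const i)) (Const 1)))))"

lemma regs_written_force_indices [simp]: "regs_written (force_indices k) = {}"
  by (induction k) auto

lemma arrs_written_force_indices: "A \<in> arrs_written (force_indices k) \<Longrightarrow> A = 2"
  by (induction k) auto

lemma card_less_Suc:
  "card {i. i < Suc k \<and> P i} = card {i. i < k \<and> P i} + (if P k then 1 else 0)"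
proof -
  have "{i. i < Suc k \<and> P i} = (if P k then insert k {i. i < k \<and> P i} else {i. i < k \<and> P i})"
    by (auto simp: less_Suc_eq)
  then show ?thesis by simp
qed

section \<open>Correctness of the search algorithm\<close>

locale weighted_system =
  fixes n :: nat and S :: "int vec set" and LO :: "int vec \<Rightarrow> int vec" and w :: "int vec" and f :: "int \<Rightarrow> real"
  assumes indep: "independence_system n S" and lin_opt: "lin_opt_oracle n S LO"
    and w_carrier: "w \<in> carrier_vec n" and w_pos: "\<And>j. j < n \<Longrightarrow> 0 < w $ j"
begin

sublocale machine n LO "comparison_oracle f" .

lemma dim_w [simp]: "dim_vec w = n" using w_carrier by simp

lemma S_zero_one: "x \<in> S \<Longrightarrow> x \<in> carrier_vec n" "x \<in> S \<Longrightarrow> j < n \<Longrightarrow> x $ j = 0 \<or> x $ j = 1"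
  using indep unfolding independence_system_def zero_one_vecs_def by auto

lemma S_downward:
  assumes "x \<in> S" "y \<in> carrier_vec n" "\<And>j. j < n \<Longrightarrow> y $ j = 0 \<or> y $ j = 1 \<and> x $ j = 1"
  shows "y \<in> S"
proof -
  have "y \<in> zero_one_vecs n" using assms(2,3) by (auto simp: zero_one_vecs_def)
  moreover have "y \<le> x" using assms S_zero_one[OF assms(1)] by (force simp: less_eq_vec_def)
  ultimately show ?thesis using indep assms(1) unfolding independence_system_def by blast
qed

lemma LO_in_S: "v \<in> carrier_vec n \<Longrightarrow> LO v \<in> S"
  using lin_opt by (auto simp: lin_opt_oracle_def)

lemma objective_carrier: "objective w T M \<in> carrier_vec n" by (simp add: objective_def)

lemma thin_out_in_S: "x \<in> S \<Longrightarrow> thin_out w x C \<in> S"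
  by (rule S_downward) (auto simp: thin_out_def)

definition candidate :: "nat \<Rightarrow> (nat \<Rightarrow> int \<Rightarrow> int) \<Rightarrow> int vec" where
  "candidate k h = thin_out w (LO (objective w (h 7 ` int ` {..<k}) (h 6))) (h 4)"

lemma candidate_in_S: "candidate k h \<in> S"
  unfolding candidate_def by (intro thin_out_in_S LO_in_S objective_carrier)

definition input_ok :: "state \<Rightarrow> bool" where
  "input_ok s \<longleftrightarrow> regs s 0 = int n \<and> (\<forall>j<n. arrs s 0 (int j) = w $ j)"

lemma achieves_build_objective:
  assumes "input_ok s"
  shows "achieves build_objective (\<lambda>s'. regs s' 5 = 1 + (\<Sum>i<n. w $ i) \<and>
      (\<forall>j<n. arrs s' 2 (int j) = objective w {} (arrs s 6) $ j) \<and>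
      (\<forall>j<n. arrs s' 8 (w $ j) = arrs s 4 (w $ j))) s"
  unfolding build_objective_def
proof (intro achieves_Seq achieves_Assign, rule achieves_While[where N = n and
    I = "\<lambda>k s'. regs s' 1 = int k \<and> regs s' 5 = 1 + (\<Sum>i<k. w $ i) \<and>
      (\<forall>j<k. arrs s' 2 (int j) = objective w {} (arrs s 6) $ j) \<and>
      (\<forall>j<k. arrs s' 8 (w $ j) = arrs s 4 (w $ j))"], goal_cases)
  case (3 k s')
  have "regs s' 0 = int n" "arrs s' 0 = arrs s 0" "arrs s' 6 = arrs s 6" "arrs s' 4 = arrs s 4"
    using 3(2) assms by (auto simp: unchanged_def input_ok_def)
  moreover have "arrs s 0 (int k) = w $ k" using 3(1) assms by (simp add: input_ok_def)
  ultimately show ?case using 3(1,3)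
    by (auto intro!: achieves_Seq achieves_Assign achieves_Store achieves_Cond
        simp: less_Suc_eq objective_def)
next
  case (4 s')
  then show ?case using assms by (auto simp: unchanged_def input_ok_def)
qed auto

lemma achieves_force_indices:
  assumes "regs s 5 = 1 + (\<Sum>i<n. w $ i)" "\<forall>j<n. arrs s 2 (int j) = objective w {} M $ j"
  shows "achieves (force_indices k)
      (\<lambda>s'. \<forall>j<n. arrs s' 2 (int j) = objective w (arrs s 7 ` int ` {..<k}) M $ j) s"
proof (induction k)
  case 0
  then show ?case using assms by (auto intro: achieves_Skip)
next
  case (Suc k)
  show ?case unfolding force_indices.simps
  proof (rule achieves_Seq, rule achieves_mono[OF Suc], rule achieves_Store, goal_cases)
    case (1 s')
    have "regs s' 5 = regs s 5" "arrs s' 7 = arrs s 7"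
      using 1(1) arrs_written_force_indices[of 7 k] by (auto simp: unchanged_def)
    then show ?case using 1(2) assms(1) by (auto simp: objective_def lessThan_Suc)
  qed
qed

lemma achieves_build_candidate:
  assumes "input_ok s" "x \<in> S" "\<forall>j<n. arrs s 3 (int j) = x $ j" "\<forall>j<n. arrs s 8 (w $ j) = C (w $ j)"
  shows "achieves build_candidate (\<lambda>s'. vec_of_array n (arrs s' 5) = thin_out w x C \<and>
      regs s' 2 = w \<bullet> thin_out w x C) s"
  unfolding build_candidate_def
proof (intro achieves_Seq achieves_Assign, rule achieves_While[where N = n and
    I = "\<lambda>k s'. regs s' 1 = int k \<and> regs s' 2 = (\<Sum>i<k. w $ i * thin_out w x C $ i) \<and>
      (\<forall>j<k. arrs s' 5 (int j) = thin_out w x C $ j) \<and>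
      (\<forall>j<n. arrs s' 8 (w $ j) = C (w $ j) - int (card {i. i < k \<and> x $ i = 1 \<and> w $ i = w $ j}))"], goal_cases)
  case 2
  then show ?case using assms by simp
next
  case (3 k s')
  have "regs s' 0 = int n" "arrs s' 0 = arrs s 0" "arrs s' 3 = arrs s 3"
    using 3(2) assms by (auto simp: unchanged_def input_ok_def)
  moreover have "arrs s 0 (int k) = w $ k" using 3(1) assms by (simp add: input_ok_def)
  moreover have reg1: "regs s' 1 = int k" using 3(3) by blast
  ultimately have vals: "aval (Reg 1) s' = int k" "aval (Arr 0 (Reg 1)) s' = w $ k"
    "aval (Arr 3 (Reg 1)) s' = x $ k" "regs s' 0 = int n"
    using 3(1) assms(3) by simp_all
  have counter: "arrs s' 8 (w $ j) = C (w $ j) - int (card {i. i < k \<and> x $ i = 1 \<and> w $ i = w $ j})"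
    if "j < n" for j using 3(3) that by blast
  have done_eq: "\<forall>j<k. arrs s' 5 (int j) = thin_out w x C $ j"
    and val: "regs s' 2 = (\<Sum>i<k. w $ i * thin_out w x C $ i)"
    using 3(3) by blast+
  have pos: "0 < aval (Minus (Reg 0) (Reg 1)) s'" using 3(1) vals by simp
  have thin: "thin_out w x C $ k = (if x $ k = 1 \<and> 0 < arrs s' 8 (w $ k) then 1 else 0)"
    using counter[OF 3(1)] 3(1) by (simp add: thin_out_def)
  consider "x $ k = 0" | "x $ k = 1" using S_zero_one(2)[OF assms(2) 3(1)] by blast
  then show ?case
  proof cases
    case 1
    then have "card {i. i < Suc k \<and> x $ i = 1 \<and> w $ i = w $ j} = card {i. i < k \<and> x $ i = 1 \<and> w $ i = w $ j}" for j
      by (simp add: card_less_Suc)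
    then show ?thesis using 1 vals pos counter done_eq val thin
      by (intro conjI achieves_Seq achieves_Assign achieves_Store achieves_Cond) (simp_all add: All_less_Suc)
  next
    case 2
    then have "int (card {i. i < Suc k \<and> x $ i = 1 \<and> w $ i = w $ j}) =
        int (card {i. i < k \<and> x $ i = 1 \<and> w $ i = w $ j}) + (if w $ j = w $ k then 1 else 0)" for j
      by (simp add: card_less_Suc)
    then show ?thesis using 2 vals pos counter done_eq val thin 3(1)
      by (intro conjI achieves_Seq achieves_Assign achieves_Store achieves_Cond) (simp_all add: All_less_Suc)
  qed
next
  case (4 s')
  have "regs s' 0 = int n" using 4 assms by (auto simp: unchanged_def input_ok_def)
  moreover have "vec_of_array n (arrs s' 5) = thin_out w x C"
    using 4(2) by (auto simp: vec_of_array_def thin_out_def)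
  ultimately show ?case using 4(2)
    by (simp add: scalar_prod_def thin_out_def lessThan_atLeast0)
qed auto

definition incumbent_ok :: "state \<Rightarrow> bool" where
  "incumbent_ok s \<longleftrightarrow> input_ok s \<and> vec_of_array n (arrs s 1) \<in> S \<and>
     regs s 3 = w \<bullet> vec_of_array n (arrs s 1)"

lemma achieves_keep_better:
  assumes "incumbent_ok s" "vec_of_array n (arrs s 5) = y" "y \<in> S" "regs s 2 = w \<bullet> y"
  shows "achieves keep_better (\<lambda>s'. incumbent_ok s' \<and> f (regs s' 3) \<le> f (regs s 3) \<and>
      f (regs s' 3) \<le> f (w \<bullet> y)) s"
  unfolding keep_better_def
proof (intro achieves_Seq achieves_Compare achieves_Cond achieves_Skip achieves_Assign, goal_cases)
  case 1
  then show ?case using assms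
    by (auto simp: incumbent_ok_def input_ok_def comparison_oracle_def split: if_splits)
next
  case 2
  then have less: "f (regs s 2) < f (regs s 3)" by (auto simp: comparison_oracle_def split: if_splits)
  show ?case
  proof (rule achieves_While[where N = n and I = "\<lambda>k s'. regs s' 1 = int k \<and>
      (\<forall>j<k. arrs s' 1 (int j) = arrs s 5 (int j))"], goal_cases)
    case (3 k s')
    then have "regs s' 0 = int n" "arrs s' 5 = arrs s 5"
      using assms(1) by (auto simp: unchanged_def input_ok_def incumbent_ok_def)
    then show ?case using 3
      by (auto intro!: achieves_Seq achieves_Assign achieves_Store simp: less_Suc_eq)
  next
    case (4 s')
    then have "vec_of_array n (arrs s' 1) = y" using assms(2) by (auto simp: vec_of_array_def)
    moreover have "regs s' 0 = int n" "arrs s' 0 = arrs s 0" "regs s' 3 = regs s 2"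
      using 4 assms(1) by (auto simp: unchanged_def input_ok_def incumbent_ok_def)
    ultimately show ?case using 4 assms less by (auto simp: incumbent_ok_def input_ok_def)
  qed auto
qed

lemma achieves_try_parameters:
  assumes "incumbent_ok s"
  shows "achieves (try_parameters k) (\<lambda>s'. incumbent_ok s' \<and> f (regs s' 3) \<le> f (regs s 3) \<and>
      f (regs s' 3) \<le> f (w \<bullet> candidate k (arrs s))) s"
  unfolding try_parameters_def
proof (rule achieves_Seq, rule achieves_mono[OF achieves_build_objective], goal_cases)
  case 1
  then show ?case using assms by (simp add: incumbent_ok_def)
next
  case (2 s1)
  note s1 = 2
  have u1: "regs s1 0 = regs s 0" "regs s1 3 = regs s 3"
    "\<And>A. A \<notin> {2, 8} \<Longrightarrow> arrs s1 A = arrs s A"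
    using s1(1) by (auto simp: unchanged_def build_objective_def)
  show ?case
  proof (rule achieves_Seq, rule achieves_mono[OF achieves_force_indices[of s1 "arrs s 6"]], goal_cases)
    case (3 s2)
    have u2: "regs s2 = regs s1" "\<And>A. A \<noteq> 2 \<Longrightarrow> arrs s2 A = arrs s1 A"
      using 3(1) arrs_written_force_indices[of _ k] unfolding unchanged_def by auto
    let ?x = "LO (objective w (arrs s 7 ` int ` {..<k}) (arrs s 6))"
    have v: "vec_of_array n (arrs s2 2) = objective w (arrs s 7 ` int ` {..<k}) (arrs s 6)"
      using 3(2) u1(3)[of 7] by (auto simp: vec_of_array_def objective_def)
    have xS: "?x \<in> S" by (intro LO_in_S objective_carrier)
    show ?case
    proof (intro achieves_Seq achieves_LinOpt,
        rule achieves_mono[OF achieves_build_candidate[where x = ?x and C = "arrs s 4"]], goal_cases)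
      case 1
      then show ?case using assms u1 u2 by (simp add: incumbent_ok_def input_ok_def)
    next
      case 2
      then show ?case by (rule xS)
    next
      case 3
      then show ?case by (simp add: v write_vec_def)
    next
      case 4
      then show ?case using s1(2) u1 u2 by simp
    next
      case (5 s3)
      then have u3: "regs s3 0 = regs s 0" "regs s3 3 = regs s 3"
        "arrs s3 0 = arrs s 0" "arrs s3 1 = arrs s 1"
        using u1 u2 by (auto simp: unchanged_def build_candidate_def)
      have "incumbent_ok s3"
        using assms u3 by (simp add: incumbent_ok_def input_ok_def)
      then show ?case
        using achieves_keep_better[of s3 "candidate k (arrs s)"] 5(2) candidate_in_S[of k "arrs s"] u3
        by (simp add: candidate_def)
    qed
  qed (use s1 in auto)
qed

lemma arrs_written_try_parameters: "arrs_written (try_parameters k) \<subseteq> {1, 2, 3, 5, 8}"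
proof -
  have "arrs_written (force_indices k) \<subseteq> {2}" using arrs_written_force_indices by blast
  then show ?thesis
    unfolding try_parameters_def build_objective_def build_candidate_def keep_better_def arrs_written.simps
    by blast
qed

end

context weighted_system
begin

definition varies_on :: "(nat \<times> int) set \<Rightarrow> (nat \<Rightarrow> int \<Rightarrow> int) \<Rightarrow> (nat \<Rightarrow> int \<Rightarrow> int) \<Rightarrow> bool" where
  "varies_on cells g h \<longleftrightarrow> (\<forall>A\<in>{4, 6, 7}. \<forall>i. if (A, i) \<in> cells then h A i \<in> {0..int n} else h A i = g A i)"

lemma varies_on_range:
  assumes "varies_on cells g h" "(A, i) \<in> cells" "A \<in> {4, 6, 7}"
  shows "0 \<le> h A i" "h A i \<le> int n"
proof -
  have "if (A, i) \<in> cells then h A i \<in> {0..int n} else h A i = g A i"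
    using assms(1,3) unfolding varies_on_def by blast
  then show "0 \<le> h A i" "h A i \<le> int n" using assms(2) by auto
qed

lemma varies_on_cong:
  assumes "\<And>A. A \<in> {4, 6, 7} \<Longrightarrow> g A = g' A"
  shows "varies_on cells g h = varies_on cells g' h"
  unfolding varies_on_def by (intro ball_cong refl) (simp only: assms)

lemma candidate_cong: "(\<And>A i. A \<in> {4, 6, 7} \<Longrightarrow> h A i = g A i) \<Longrightarrow> candidate k h = candidate k g"
  by (simp add: candidate_def ext[of "h 4" "g 4"] ext[of "h 6" "g 6"] ext[of "h 7" "g 7"])

definition searched :: "nat \<Rightarrow> (nat \<times> int) set \<Rightarrow> state \<Rightarrow> state \<Rightarrow> bool" where
  "searched k cells s s' \<longleftrightarrow> incumbent_ok s' \<and> f (regs s' 3) \<le> f (regs s 3) \<and>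
     (\<forall>h. varies_on cells (arrs s) h \<longrightarrow> f (regs s' 3) \<le> f (w \<bullet> candidate k h)) \<and>
     (\<forall>A\<in>{4, 6, 7}. \<forall>i. (A, i) \<notin> cells \<longrightarrow> arrs s' A i = arrs s A i)"

text \<open>By induction on the list of cells. The loop over one cell has the invariant that all fillings with
  a smaller entry in this cell have been tried.\<close>

lemma achieves_for_all_cells:
  assumes "fst ` set cells \<subseteq> {4, 6, 7}" "distinct cells" "incumbent_ok s"
  shows "achieves (for_all_cells cells (try_parameters k)) (searched k (set cells) s) s"
  using assms
proof (induction cells arbitrary: s)
  case Nil
  have "candidate k h = candidate k (arrs s)" if "varies_on {} (arrs s) h" for h
    using that by (intro candidate_cong) (auto simp: varies_on_def)
  moreover have "arrs s' A = arrs s A" if "unchanged (try_parameters k) s s'" "A \<in> {4, 6, 7}" for s' A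
    using that arrs_written_try_parameters[of k] by (auto simp: unchanged_def)
  ultimately show ?case
    unfolding for_all_cells.simps searched_def
    by (intro achieves_mono[OF achieves_try_parameters[OF Nil(3), of k]]) auto
next
  case (Cons cell cells)
  obtain A i where cell: "cell = (A, i)" by fastforce
  have A: "A \<in> {4, 6, 7}" and new: "(A, i) \<notin> set cells"
    using Cons.prems(1,2) unfolding cell by auto
  have "fst ` set cells \<subseteq> {4, 6, 7}" "distinct cells" using Cons.prems(1,2) by auto
  note IH = Cons.IH[OF this]
  let ?I = "\<lambda>m s'. incumbent_ok s' \<and> f (regs s' 3) \<le> f (regs s 3) \<and> arrs s' A i = int m \<and>
        (\<forall>h. varies_on (insert (A, i) (set cells)) (arrs s) h \<and> h A i < int m \<longrightarrow>
          f (regs s' 3) \<le> f (w \<bullet> candidate k h)) \<and>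
        (\<forall>B\<in>{4, 6, 7}. \<forall>j. (B, j) \<notin> insert (A, i) (set cells) \<longrightarrow> arrs s' B j = arrs s B j)"
  show ?case unfolding cell for_all_cells.simps
  proof (rule achieves_Seq, rule achieves_Store, rule achieves_While[where N = "n + 1" and
      I = ?I], goal_cases)
    case 2
    have none: "\<not> (varies_on (insert (A, i) (set cells)) (arrs s) h \<and> h A i < int 0)" for h
      using varies_on_range[of "insert (A, i) (set cells)" "arrs s" h A i] A by auto
    have A01: "A \<noteq> 0" "A \<noteq> 1" using A by auto
    show ?case
    proof (intro conjI)
      show "incumbent_ok (s\<lparr>arrs := (arrs s)(A := (arrs s A)(aval (Const i) s := aval (Const 0) s))\<rparr>)"
        using Cons.prems(3) A01 by (simp add: incumbent_ok_def input_ok_def)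
    qed (use none in auto)
  next
    case (3 m s1)
    from 3(3) have ok: "incumbent_ok s1" and better: "f (regs s1 3) \<le> f (regs s 3)"
      and cell_m: "arrs s1 A i = int m"
      and tried: "\<forall>h. varies_on (insert (A, i) (set cells)) (arrs s) h \<and> h A i < int m \<longrightarrow>
          f (regs s1 3) \<le> f (w \<bullet> candidate k h)"
      and same: "\<forall>B\<in>{4, 6, 7}. \<forall>j. (B, j) \<notin> insert (A, i) (set cells) \<longrightarrow> arrs s1 B j = arrs s B j"
      by - (iprover+)
    have "achieves (Seq (for_all_cells cells (try_parameters k))
        (Store A (Const i) (Plus (Arr A (Const i)) (Const 1)))) (?I (Suc m)) s1"
    proof (rule achieves_Seq, rule achieves_mono[OF IH[OF ok]], rule achieves_Store)
      fix s2 assume s2: "searched k (set cells) s1 s2"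
      have keep: "\<forall>B\<in>{4, 6, 7}. \<forall>j. (B, j) \<notin> set cells \<longrightarrow> arrs s2 B j = arrs s1 B j"
        and best: "\<forall>h. varies_on (set cells) (arrs s1) h \<longrightarrow> f (regs s2 3) \<le> f (w \<bullet> candidate k h)"
        and ok2: "incumbent_ok s2" and better2: "f (regs s2 3) \<le> f (regs s1 3)"
        using s2 unfolding searched_def by - (iprover+)
      let ?s3 = "s2\<lparr>arrs := (arrs s2)(A := (arrs s2 A)(aval (Const i) s2 :=
        aval (Plus (Arr A (Const i)) (Const 1)) s2))\<rparr>"
      show "?I (Suc m) ?s3"
      proof (intro conjI allI impI)
        show "incumbent_ok ?s3"
          using ok2 A by (auto simp: incumbent_ok_def input_ok_def)
        show "f (regs ?s3 3) \<le> f (regs s 3)" using better2 better by simp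
        show "arrs ?s3 A i = int (Suc m)" using keep A new cell_m by auto
        show "\<forall>B\<in>{4, 6, 7}. \<forall>j. (B, j) \<notin> insert (A, i) (set cells) \<longrightarrow> arrs ?s3 B j = arrs s B j"
          using keep same by auto
        fix h assume h: "varies_on (insert (A, i) (set cells)) (arrs s) h \<and> h A i < int (Suc m)"
        have "f (regs s2 3) \<le> f (w \<bullet> candidate k h)"
        proof (cases "h A i < int m")
          case True
          then show ?thesis using tried h better2 by (meson order_trans)
        next
          case False
          then have hm: "h A i = int m" using h by simp
          have "if (B, j) \<in> set cells then h B j \<in> {0..int n} else h B j = arrs s1 B j"
            if B: "B \<in> {4, 6, 7}" for B j
          proof (cases "(B, j) = (A, i)")
            case True
            then show ?thesis using new hm cell_m by simp
          next
            case False
            have "if (B, j) \<in> insert (A, i) (set cells) then h B j \<in> {0..int n} else h B j = arrs s B j"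
              using h B unfolding varies_on_def by blast
            moreover have "(B, j) \<notin> insert (A, i) (set cells) \<Longrightarrow> arrs s1 B j = arrs s B j"
              using same B by blast
            ultimately show ?thesis using False by (auto split: if_splits)
          qed
          then have "varies_on (set cells) (arrs s1) h" unfolding varies_on_def by blast
          then show ?thesis using best by blast
        qed
        then show "f (regs ?s3 3) \<le> f (w \<bullet> candidate k h)" by simp
      qed
    qed
    moreover have "regs s1 0 = int n" using ok by (simp add: incumbent_ok_def input_ok_def)
    ultimately show ?case using 3(1) cell_m by simp
  next
    case (4 s')
    then have "regs s' 0 = int n" by (simp add: incumbent_ok_def input_ok_def)
    moreover have "h A i < int (n + 1)" if "varies_on (insert (A, i) (set cells)) (arrs s) h" for h
      using varies_on_range[OF that _ A, of i] by simp
    moreover from 4(2) have "arrs s' A i = int (n + 1)" by iprover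
    moreover have "searched k (set ((A, i) # cells)) s s'"
      unfolding searched_def list.set using 4(2) calculation(2) by blast
    ultimately show ?case by simp
  qed simp
qed

end

definition parameter_cells :: "nat list \<Rightarrow> nat \<Rightarrow> (nat \<times> int) list" where
  "parameter_cells a k = map (\<lambda>i. (7, int i)) [0..<k] @ map (\<lambda>\<alpha>. (4, int \<alpha>)) a @ map (\<lambda>\<alpha>. (6, int \<alpha>)) a"

definition search_algorithm :: "nat list \<Rightarrow> nat \<Rightarrow> com" where
  "search_algorithm a k = for_all_cells (parameter_cells a k) (try_parameters k)"

context weighted_system
begin

lemma search_algorithm_tries_all:
  assumes "distinct a"
  shows "\<exists>t s'. exec n LO (comparison_oracle f) (search_algorithm a k) (initial_state n w) t s' \<and>
    t \<le> poly (time_poly (search_algorithm a k)) n \<and> result_vec n s' \<in> S \<and>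
    (\<forall>h. varies_on (set (parameter_cells a k)) (\<lambda>_ _. 0) h \<longrightarrow>
      f (w \<bullet> result_vec n s') \<le> f (w \<bullet> candidate k h))"
proof -
  let ?s = "initial_state n w"
  have arr: "arrs ?s A = (\<lambda>_. 0)" if "A \<noteq> 0" for A
    using that by (simp add: initial_state_def)
  obtain x where x: "x \<in> S" using indep by (auto simp: independence_system_def)
  have zero: "vec_of_array n (arrs ?s 1) = 0\<^sub>v n" by (auto simp: arr vec_of_array_def)
  have "0\<^sub>v n \<in> S" by (rule S_downward[OF x]) auto
  then have "incumbent_ok ?s"
    using zero w_carrier unfolding incumbent_ok_def input_ok_def
    by (simp add: initial_state_def write_vec_def)
  moreover have "distinct (parameter_cells a k)"
    using assms by (auto simp: parameter_cells_def distinct_map inj_on_def)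
  moreover have "fst ` set (parameter_cells a k) \<subseteq> {4, 6, 7}" by (auto simp: parameter_cells_def)
  ultimately have "achieves (search_algorithm a k) (searched k (set (parameter_cells a k)) ?s) ?s"
    unfolding search_algorithm_def by (intro achieves_for_all_cells)
  then obtain t s' where run: "exec n LO (comparison_oracle f) (search_algorithm a k) ?s t s'"
      "t \<le> poly (time_poly (search_algorithm a k)) n" "searched k (set (parameter_cells a k)) ?s s'"
    unfolding achieves_def by blast
  have "varies_on cells (arrs ?s) h = varies_on cells (\<lambda>_ _. 0) h" for cells h
    by (rule varies_on_cong) (use arr in auto)
  then show ?thesis
    using run unfolding searched_def incumbent_ok_def result_vec_def by metis
qed

lemma objective_cong:
  assumes "\<And>j. j < n \<Longrightarrow> int j \<in> T \<longleftrightarrow> int j \<in> T'" "\<And>j. j < n \<Longrightarrow> 0 < M (w $ j) \<longleftrightarrow> 0 < M' (w $ j)"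
  shows "objective w T M = objective w T' M'"
  using assms by (auto simp: objective_def)

lemma thin_out_cong:
  assumes "\<And>j. j < n \<Longrightarrow> C (w $ j) = C' (w $ j)"
  shows "thin_out w x C = thin_out w x C'"
  using assms by (auto simp: thin_out_def)

text \<open>A set \<open>T\<close> with fewer than \<open>k\<close> elements is entered into the \<open>k\<close> cells of array 7 with the padding \<open>n\<close>, which is
  not an index. A positive mask entry is encoded as \<open>n\<close>, which is positive as soon as there is any
  element, so that no case distinction for \<open>n = 0\<close> arises.\<close>

lemma parameters_realize:
  assumes w_a: "\<And>j. j < n \<Longrightarrow> w $ j \<in> int ` set a" and T: "T \<subseteq> {..<n}" "card T \<le> k"
    and c: "\<And>\<alpha>. \<alpha> \<in> set a \<Longrightarrow> c \<alpha> \<le> n"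
  shows "\<exists>h. varies_on (set (parameter_cells a k)) (\<lambda>_ _. 0) h \<and>
    candidate k h = thin_out w (LO (objective w (int ` T) (\<lambda>\<alpha>. of_bool (nat \<alpha> \<in> L)))) (\<lambda>\<alpha>. int (c (nat \<alpha>)))"
proof -
  have "finite T" using T(1) finite_subset by blast
  then obtain g where g: "bij_betw g {0..<card T} T" using ex_bij_betw_nat_finite by blast
  define h7 where "h7 = (\<lambda>i. if 0 \<le> i \<and> i < int k then if nat i < card T then int (g (nat i)) else int n else 0)"
  define h6 where "h6 = (\<lambda>\<alpha>. if \<alpha> \<in> int ` set a \<and> nat \<alpha> \<in> L then int n else 0)"
  define h4 where "h4 = (\<lambda>\<alpha>. if \<alpha> \<in> int ` set a then int (c (nat \<alpha>)) else 0)"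
  define h where "h = (\<lambda>A::nat. if A = 7 then h7 else if A = 6 then h6 else h4)"
  have gT: "g i < n" if "i < card T" for i
    using bij_betwE[OF g] that T(1) by force
  have "varies_on (set (parameter_cells a k)) (\<lambda>_ _. 0) h"
    unfolding varies_on_def
  proof (intro ballI allI)
    fix A :: nat and i :: int assume "A \<in> {4, 6, 7}"
    then consider "A = 4" | "A = 6" | "A = 7" by blast
    then show "if (A, i) \<in> set (parameter_cells a k) then h A i \<in> {0..int n} else h A i = 0"
    proof cases
      case 3
      have "(7, i) \<in> set (parameter_cells a k) \<longleftrightarrow> 0 \<le> i \<and> i < int k"
        by (auto simp: parameter_cells_def image_iff intro: bexI[of _ "nat i"])
      then show ?thesis using 3 gT[of "nat i"] by (auto simp: h_def h7_def less_imp_le)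
    qed (use c in \<open>auto simp: h_def h6_def h4_def parameter_cells_def\<close>)
  qed
  moreover have "objective w (h 7 ` int ` {..<k}) (h 6) = objective w (int ` T) (\<lambda>\<alpha>. of_bool (nat \<alpha> \<in> L))"
  proof (rule objective_cong)
    fix j assume j: "j < n"
    show "int j \<in> h 7 ` int ` {..<k} \<longleftrightarrow> int j \<in> int ` T"
    proof
      assume "int j \<in> h 7 ` int ` {..<k}"
      then obtain i where "i < k" "int j = h7 (int i)" by (auto simp: h_def)
      then have "i < card T" "j = g i" using j by (auto simp: h7_def split: if_splits)
      then show "int j \<in> int ` T" using bij_betwE[OF g] by auto
    next
      assume "int j \<in> int ` T"
      then have "j \<in> T" by auto
      then have "j \<in> g ` {0..<card T}" using g unfolding bij_betw_def by blast
      then obtain i where "i < card T" "g i = j" by auto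
      then have "h 7 (int i) = int j" "i < k" using T(2) by (auto simp: h_def h7_def)
      then show "int j \<in> h 7 ` int ` {..<k}" by (metis imageI lessThan_iff)
    qed
    show "0 < h 6 (w $ j) \<longleftrightarrow> 0 < (of_bool (nat (w $ j) \<in> L) :: int)"
      using w_a[OF j] j by (auto simp: h_def h6_def)
  qed
  moreover have "thin_out w x (h 4) = thin_out w x (\<lambda>\<alpha>. int (c (nat \<alpha>)))" for x
    by (rule thin_out_cong) (use w_a in \<open>auto simp: h_def h4_def\<close>)
  ultimately show ?thesis unfolding candidate_def by metis
qed

end

section \<open>What the search may miss\<close>

lemma card_first_elements:
  fixes N :: "nat set"
  assumes "finite N"
  shows "card {j \<in> N. card {i \<in> N. i < j} < c} = min c (card N)"
  using assms
proof (induction N rule: finite_linorder_max_induct)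
  case empty
  then show ?case by simp
next
  case (insert b N)
  then have b: "b \<notin> N" by auto
  have below: "{i \<in> insert b N. i < j} = {i \<in> N. i < j}" if "j \<in> N" for j
    using insert.hyps that by auto
  have top: "{i \<in> insert b N. i < b} = N" using insert.hyps by auto
  have "{j \<in> N. card {i \<in> insert b N. i < j} < c} = {j \<in> N. card {i \<in> N. i < j} < c}"
    by (intro Collect_cong conj_cong refl) (simp only: below)
  moreover have "{j \<in> insert b N. card {i \<in> insert b N. i < j} < c} =
      {j \<in> N. card {i \<in> insert b N. i < j} < c} \<union> (if card {i \<in> insert b N. i < b} < c then {b} else {})"
    by (simp only: insert_iff split: if_split) blast
  ultimately have "{j \<in> insert b N. card {i \<in> insert b N. i < j} < c} =
      {j \<in> N. card {i \<in> N. i < j} < c} \<union> (if card N < c then {b} else {})"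
    by (simp only: top)
  then show ?case using insert.hyps insert.IH b by simp
qed

context weighted_system
begin

definition supp :: "int vec \<Rightarrow> nat set" where
  "supp x = {j. j < n \<and> x $ j = 1}"

definition class_count :: "int vec \<Rightarrow> nat \<Rightarrow> nat" where
  "class_count x \<alpha> = card {j \<in> supp x. w $ j = int \<alpha>}"

lemma finite_supp [simp]: "finite (supp x)" by (simp add: supp_def)

lemma supp_less: "j \<in> supp x \<Longrightarrow> j < n" by (simp add: supp_def)

lemma class_count_le: "class_count x \<alpha> \<le> n"
proof -
  have "{j \<in> supp x. w $ j = int \<alpha>} \<subseteq> {..<n}" by (auto simp: supp_def)
  from card_mono[OF _ this] show ?thesis by (simp add: class_count_def)
qed

lemma scalar_prod_supp:
  assumes "x \<in> S"
  shows "v \<bullet> x = (\<Sum>j\<in>supp x. v $ j)"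
proof -
  have "dim_vec x = n" using S_zero_one(1)[OF assms] by simp
  then have "v \<bullet> x = (\<Sum>j\<in>{0..<n}. v $ j * x $ j)" by (simp add: scalar_prod_def)
  also have "\<dots> = (\<Sum>j\<in>supp x. v $ j)"
    by (rule sum.mono_neutral_cong_right) (use S_zero_one(2)[OF assms] in \<open>fastforce simp: supp_def\<close>)+
  finally show ?thesis .
qed

lemma weight_by_class:
  assumes "x \<in> S" "finite A" "\<And>j. j < n \<Longrightarrow> w $ j \<in> int ` A"
  shows "w \<bullet> x = int (\<Sum>\<alpha>\<in>A. class_count x \<alpha> * \<alpha>)"
proof -
  have sub: "(\<lambda>j. nat (w $ j)) ` supp x \<subseteq> A" using assms(3) by (force simp: supp_def)
  have "w \<bullet> x = (\<Sum>j\<in>supp x. w $ j)" by (rule scalar_prod_supp[OF assms(1)])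
  also have "\<dots> = (\<Sum>\<alpha>\<in>A. \<Sum>j\<in>{j \<in> supp x. nat (w $ j) = \<alpha>}. w $ j)"
    by (rule sum.group[OF finite_supp assms(2) sub, symmetric])
  also have "\<dots> = (\<Sum>\<alpha>\<in>A. int (class_count x \<alpha> * \<alpha>))"
  proof (rule sum.cong[OF refl])
    fix \<alpha> assume "\<alpha> \<in> A"
    have "{j \<in> supp x. nat (w $ j) = \<alpha>} = {j \<in> supp x. w $ j = int \<alpha>}"
      using assms(3) by (force simp: supp_def)
    then show "(\<Sum>j\<in>{j \<in> supp x. nat (w $ j) = \<alpha>}. w $ j) = int (class_count x \<alpha> * \<alpha>)"
      by (simp add: class_count_def)
  qed
  finally show ?thesis by simp
qed

lemma class_count_thin_out:
  "class_count (thin_out w x (\<lambda>\<alpha>. int (c (nat \<alpha>)))) \<alpha> = min (c \<alpha>) (class_count x \<alpha>)"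
proof -
  let ?N = "{j \<in> supp x. w $ j = int \<alpha>}"
  have "{i. i < j \<and> x $ i = 1 \<and> w $ i = w $ j} = {i \<in> ?N. i < j}" if "j \<in> ?N" for j
    using that by (auto simp: supp_def)
  then have "{j \<in> supp (thin_out w x (\<lambda>\<alpha>. int (c (nat \<alpha>)))). w $ j = int \<alpha>} =
      {j \<in> ?N. card {i \<in> ?N. i < j} < c \<alpha>}"
    by (auto simp: supp_def thin_out_def split: if_splits)
  then have "class_count (thin_out w x (\<lambda>\<alpha>. int (c (nat \<alpha>)))) \<alpha> = card {j \<in> ?N. card {i \<in> ?N. i < j} < c \<alpha>}"
    unfolding class_count_def by (rule arg_cong)
  also have "\<dots> = min (c \<alpha>) (card ?N)" by (rule card_first_elements) simp
  finally show ?thesis by (simp only: class_count_def)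
qed

text \<open>Missing an element of \<open>T\<close> would lose a bonus that all other elements together cannot make up for,
  whereas \<open>y\<close> collects all bonuses; this forces \<open>T \<subseteq> supp x\<close>. An element with entry \<open>-1\<close> could be
  dropped, as the system is closed downwards. Finally, both \<open>x\<close> and \<open>y\<close> collect the same bonuses,
  and outside \<open>T\<close> both consist of elements that count with their weights, so comparing objective
  values compares weights.\<close>

lemma objective_maximizer:
  assumes y: "y \<in> S" and T: "T \<subseteq> supp y" and M: "\<And>j. j \<in> supp y - T \<Longrightarrow> M (w $ j) > 0"
  defines "x \<equiv> LO (objective w (int ` T) M)"
  shows "x \<in> S" "T \<subseteq> supp x" "\<And>j. j \<in> supp x - T \<Longrightarrow> M (w $ j) > 0" "w \<bullet> y \<le> w \<bullet> x"
proof -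
  let ?v = "objective w (int ` T) M"
  define B where "B = 1 + (\<Sum>i<n. w $ i)"
  have w_nonneg: "0 \<le> w $ j" if "j < n" for j using w_pos[OF that] by simp
  have "0 \<le> (\<Sum>i<n. w $ i)" by (rule sum_nonneg) (simp add: w_nonneg)
  then have Bpos: "0 < B" unfolding B_def by simp
  have finT: "finite T" using T finite_subset by (metis finite_supp)
  have v: "?v $ j = (if j \<in> T then B else if M (w $ j) > 0 then w $ j else -1)" if "j < n" for j
    using that by (auto simp: objective_def B_def)
  show xS: "x \<in> S" unfolding x_def by (intro LO_in_S objective_carrier)
  have opt: "?v \<bullet> z \<le> ?v \<bullet> x" if "z \<in> S" for z
    using lin_opt objective_carrier that unfolding lin_opt_oracle_def x_def by blast
  have vle: "?v $ j \<le> w $ j" if "j < n" "j \<notin> T" for j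
    using v[OF that(1)] that w_pos[OF that(1)] by (simp split: if_splits)
  have split: "?v \<bullet> z = int (card (supp z \<inter> T)) * B + (\<Sum>j\<in>supp z - T. ?v $ j)" if "z \<in> S" for z
  proof -
    have "?v \<bullet> z = (\<Sum>j\<in>supp z \<inter> T. ?v $ j) + (\<Sum>j\<in>supp z - T. ?v $ j)"
      unfolding scalar_prod_supp[OF that] by (rule sum.Int_Diff) simp
    also have "(\<Sum>j\<in>supp z \<inter> T. ?v $ j) = (\<Sum>j\<in>supp z \<inter> T. B)"
      by (rule sum.cong) (auto simp: v supp_def)
    finally show ?thesis by simp
  qed
  have rest: "?v $ j = w $ j" if "j \<in> supp z - T" "M (w $ j) > 0" for j z
    using v[of j] supp_less[of j z] that by simp
  have y_rest: "(\<Sum>j\<in>supp y - T. ?v $ j) = (\<Sum>j\<in>supp y - T. w $ j)"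
    by (rule sum.cong[OF refl]) (rule rest, assumption, rule M, assumption)
  show Tx: "T \<subseteq> supp x"
  proof (rule ccontr)
    assume "\<not> T \<subseteq> supp x"
    then have "card (supp x \<inter> T) < card T" by (intro psubset_card_mono finT) auto
    then have "int (card (supp x \<inter> T)) * B \<le> (int (card T) - 1) * B"
      using Bpos by (intro mult_right_mono) auto
    moreover have "(\<Sum>j\<in>supp x - T. ?v $ j) \<le> (\<Sum>j\<in>supp x - T. w $ j)"
      by (intro sum_mono vle) (auto simp: supp_def)
    moreover have "\<dots> \<le> (\<Sum>i<n. w $ i)"
      by (rule sum_mono2) (auto simp: supp_def w_nonneg)
    ultimately have "?v \<bullet> x < int (card T) * B"
      unfolding split[OF xS] by (simp add: B_def algebra_simps)
    moreover have "int (card T) * B \<le> ?v \<bullet> y"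
      unfolding split[OF y] y_rest Int_absorb1[OF T]
      using sum_nonneg[of "supp y - T" "\<lambda>j. w $ j"] by (simp add: supp_def w_nonneg)
    ultimately show False using opt[OF y] by simp
  qed
  show x_rest: "M (w $ j) > 0" if j: "j \<in> supp x - T" for j
  proof (rule ccontr)
    assume neg: "\<not> M (w $ j) > 0"
    define z where "z = vec n (\<lambda>i. if i = j then 0 else x $ i)"
    have zS: "z \<in> S"
      by (rule S_downward[OF xS]) (use S_zero_one(2)[OF xS] in \<open>auto simp: z_def\<close>)
    have "supp z = supp x - {j}" by (auto simp: supp_def z_def split: if_splits)
    then have "?v \<bullet> x = ?v \<bullet> z + ?v $ j"
      using j sum.remove[of "supp x" j "\<lambda>j. ?v $ j"] by (simp add: scalar_prod_supp[OF xS] scalar_prod_supp[OF zS])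
    moreover have "?v $ j = -1" using v[of j] j neg supp_less[of j x] by auto
    ultimately show False using opt[OF zS] by simp
  qed
  have "(\<Sum>j\<in>supp x - T. ?v $ j) = (\<Sum>j\<in>supp x - T. w $ j)"
    by (rule sum.cong[OF refl]) (rule rest, assumption, rule x_rest, assumption)
  then have "(\<Sum>j\<in>supp y - T. w $ j) \<le> (\<Sum>j\<in>supp x - T. w $ j)"
    using opt[OF y] y_rest T Tx unfolding split[OF xS] split[OF y] by (simp add: Int_absorb1)
  then show "w \<bullet> y \<le> w \<bullet> x"
    unfolding scalar_prod_supp[OF xS] scalar_prod_supp[OF y]
    using sum.subset_diff[OF T, of "\<lambda>j. w $ j"] sum.subset_diff[OF Tx, of "\<lambda>j. w $ j"] by simp
qed

text \<open>The properties of the oracle answer \<open>x\<close> for a right guess about \<open>y\<close>.\<close>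

definition dominates :: "nat set \<Rightarrow> nat \<Rightarrow> int vec \<Rightarrow> int vec \<Rightarrow> bool" where
  "dominates A K x y \<longleftrightarrow> w \<bullet> y \<le> w \<bullet> x \<and>
     (\<forall>\<alpha>\<in>A. if class_count y \<alpha> < K then class_count x \<alpha> = class_count y \<alpha> else K \<le> class_count x \<alpha>)"

text \<open>The guess \<open>T\<close> takes \<open>min K (class_count y \<alpha>)\<close> elements of \<open>y\<close> of each weight \<open>\<alpha>\<close>, which for light
  weights is all of them.\<close>

lemma dominating_query:
  assumes y: "y \<in> S" and A: "finite A" "\<And>j. j < n \<Longrightarrow> w $ j \<in> int ` A"
  shows "\<exists>T L. T \<subseteq> {..<n} \<and> card T \<le> K * card A \<and>
     LO (objective w (int ` T) (\<lambda>\<alpha>. of_bool (nat \<alpha> \<in> L))) \<in> S \<and>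
     dominates A K (LO (objective w (int ` T) (\<lambda>\<alpha>. of_bool (nat \<alpha> \<in> L)))) y"
proof -
  let ?N = "\<lambda>x \<alpha>. {j \<in> supp x. w $ j = int \<alpha>}"
  have "\<exists>T. T \<subseteq> ?N y \<alpha> \<and> card T = min K (class_count y \<alpha>) \<and> finite T" for \<alpha>
    using obtain_subset_with_card_n[of "min K (class_count y \<alpha>)" "?N y \<alpha>"]
    by (metis class_count_def min.cobounded2)
  then obtain t where t: "\<And>\<alpha>. t \<alpha> \<subseteq> ?N y \<alpha>" "\<And>\<alpha>. card (t \<alpha>) = min K (class_count y \<alpha>)" "\<And>\<alpha>. finite (t \<alpha>)"
    by metis
  define T where "T = (\<Union>\<alpha>\<in>A. t \<alpha>)"
  define L where "L = {\<alpha>. K \<le> class_count y \<alpha>}"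
  let ?M = "\<lambda>\<alpha>. of_bool (nat \<alpha> \<in> L) :: int"
  have small: "t \<alpha> = ?N y \<alpha>" if "class_count y \<alpha> < K" for \<alpha>
    using t[of \<alpha>] that by (intro card_subset_eq) (auto simp: class_count_def)
  have Ty: "T \<subseteq> supp y" using t(1) unfolding T_def by blast
  have "card T \<le> (\<Sum>\<alpha>\<in>A. card (t \<alpha>))" unfolding T_def by (rule card_UN_le[OF A(1)])
  also have "\<dots> \<le> (\<Sum>\<alpha>\<in>A. K)" by (rule sum_mono) (simp add: t(2))
  finally have cardT: "card T \<le> K * card A" by (simp add: mult.commute)
  have M: "0 < ?M (w $ j)" if j: "j \<in> supp y - T" for j
  proof -
    obtain \<alpha> where \<alpha>: "\<alpha> \<in> A" "w $ j = int \<alpha>" using A(2) j supp_less by blast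
    then have "j \<in> ?N y \<alpha> - t \<alpha>" using j unfolding T_def by auto
    then have "\<not> class_count y \<alpha> < K" using small by blast
    then show ?thesis using \<alpha> by (simp add: L_def)
  qed
  let ?x = "LO (objective w (int ` T) ?M)"
  note x = objective_maximizer[OF y Ty, of ?M, OF M]
  have "if class_count y \<alpha> < K then class_count ?x \<alpha> = class_count y \<alpha> else K \<le> class_count ?x \<alpha>"
    if \<alpha>: "\<alpha> \<in> A" for \<alpha>
  proof -
    have sub: "t \<alpha> \<subseteq> ?N ?x \<alpha>" using t(1)[of \<alpha>] x(2) \<alpha> unfolding T_def by blast
    show ?thesis
    proof (cases "class_count y \<alpha> < K")
      case True
      have "j \<in> ?N y \<alpha>" if "j \<in> ?N ?x \<alpha>" for j
      proof (cases "j \<in> T")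
        case True
        then show ?thesis using Ty that by blast
      next
        case False
        then have "0 < ?M (w $ j)" using x(3) that by blast
        then have "K \<le> class_count y \<alpha>" using that by (simp add: L_def split: if_splits)
        then show ?thesis using \<open>class_count y \<alpha> < K\<close> by simp
      qed
      then have "?N ?x \<alpha> = ?N y \<alpha>" using sub small[OF True] by blast
      then show ?thesis using True by (simp add: class_count_def)
    next
      case False
      then have "K = card (t \<alpha>)" using t(2) by simp
      also have "\<dots> \<le> class_count ?x \<alpha>" unfolding class_count_def using sub by (intro card_mono) auto
      finally show ?thesis using False by simp
    qed
  qed
  then have "dominates A K ?x y" using x(4) by (simp add: dominates_def)
  moreover have "T \<subseteq> {..<n}" using Ty supp_less by blast
  ultimately show ?thesis using cardT x(1) by (intro exI[of _ T] exI[of _ L] conjI)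
qed

definition signature :: "nat set \<Rightarrow> nat \<Rightarrow> int vec \<Rightarrow> nat \<Rightarrow> nat" where
  "signature A K y = restrict (\<lambda>\<alpha>. min K (class_count y \<alpha>)) A"

text \<open>Each \<open>y\<close> of signature \<open>\<sigma>\<close> has a dominating answer all of whose subsets have been tried. All these
  answers agree on the light weights and have at least \<open>K\<close> elements of each heavy weight, so one of
  largest total weight dominates every \<open>y\<close> of this signature. The light weights contribute the same
  amount \<open>c0\<close> everywhere; an unexplored value better than the result \<open>b\<close> therefore leaves a gap of
  the heavy weights.\<close>

lemma missed_values_in_gaps:
  assumes A: "finite A" "\<And>j. j < n \<Longrightarrow> w $ j \<in> int ` A"
    and tried: "\<And>T L c. T \<subseteq> {..<n} \<Longrightarrow> card T \<le> K * card A \<Longrightarrow> (\<And>\<alpha>. \<alpha> \<in> A \<Longrightarrow> c \<alpha> \<le> n) \<Longrightarrow>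
      b \<le> f (w \<bullet> thin_out w (LO (objective w (int ` T) (\<lambda>\<alpha>. of_bool (nat \<alpha> \<in> L)))) (\<lambda>\<alpha>. int (c (nat \<alpha>))))"
  shows "\<exists>l c0. (\<forall>\<alpha>\<in>A. \<sigma> \<alpha> = K \<longrightarrow> K \<le> l \<alpha>) \<and>
     {w \<bullet> y | y. y \<in> S \<and> f (w \<bullet> y) < b \<and> signature A K y = \<sigma>} \<subseteq>
     (\<lambda>g. int (c0 + g)) ` gaps {\<alpha> \<in> A. \<sigma> \<alpha> = K} l"
proof (cases "\<exists>y\<in>S. signature A K y = \<sigma>")
  case False
  then show ?thesis by (intro exI[of _ "\<lambda>_. K"]) auto
next
  case True
  let ?L = "{\<alpha> \<in> A. \<sigma> \<alpha> = K}"
  define good where "good x \<longleftrightarrow> x \<in> S \<and> (\<exists>y\<in>S. signature A K y = \<sigma> \<and> dominates A K x y) \<and>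
    (\<forall>c. (\<forall>\<alpha>\<in>A. c \<alpha> \<le> class_count x \<alpha>) \<longrightarrow> b \<le> f (int (\<Sum>\<alpha>\<in>A. c \<alpha> * \<alpha>)))" for x
  have ex_good: "\<exists>x. good x \<and> w \<bullet> y \<le> w \<bullet> x" if y: "y \<in> S" "signature A K y = \<sigma>" for y
  proof -
    obtain T L where TL: "T \<subseteq> {..<n}" "card T \<le> K * card A"
      and x: "LO (objective w (int ` T) (\<lambda>\<alpha>. of_bool (nat \<alpha> \<in> L))) \<in> S" (is "?x \<in> S")
      and dom: "dominates A K (LO (objective w (int ` T) (\<lambda>\<alpha>. of_bool (nat \<alpha> \<in> L)))) y"
      using dominating_query[OF y(1) A] by blast
    have "b \<le> f (int (\<Sum>\<alpha>\<in>A. c \<alpha> * \<alpha>))" if c: "\<forall>\<alpha>\<in>A. c \<alpha> \<le> class_count ?x \<alpha>" for c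
    proof -
      have "b \<le> f (w \<bullet> thin_out w ?x (\<lambda>\<alpha>. int (c (nat \<alpha>))))"
        using c class_count_le by (intro tried TL) (meson le_trans)
      also have "w \<bullet> thin_out w ?x (\<lambda>\<alpha>. int (c (nat \<alpha>))) =
          int (\<Sum>\<alpha>\<in>A. class_count (thin_out w ?x (\<lambda>\<alpha>. int (c (nat \<alpha>)))) \<alpha> * \<alpha>)"
        by (rule weight_by_class[OF thin_out_in_S[OF x] A])
      also have "(\<Sum>\<alpha>\<in>A. class_count (thin_out w ?x (\<lambda>\<alpha>. int (c (nat \<alpha>)))) \<alpha> * \<alpha>) = (\<Sum>\<alpha>\<in>A. c \<alpha> * \<alpha>)"
        by (rule sum.cong) (use c in \<open>auto simp: class_count_thin_out min_absorb1\<close>)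
      finally show ?thesis .
    qed
    moreover have "w \<bullet> y \<le> w \<bullet> ?x" using dom by (simp add: dominates_def)
    moreover have "\<exists>y\<in>S. signature A K y = \<sigma> \<and> dominates A K ?x y" using dom y by blast
    ultimately have "good ?x" using x unfolding good_def by blast
    then show ?thesis using \<open>w \<bullet> y \<le> w \<bullet> ?x\<close> by blast
  qed
  have good_S: "x \<in> S" if "good x" for x using that by (simp add: good_def)
  have weight: "w \<bullet> x = int (\<Sum>\<alpha>\<in>A. class_count x \<alpha> * \<alpha>)" if "x \<in> S" for x
    using weight_by_class[OF that A] .
  obtain x0 where "good x0" using True ex_good by blast
  moreover have "nat (w \<bullet> x) \<le> n * \<Sum>A" if "good x" for x
  proof -
    have "nat (w \<bullet> x) = (\<Sum>\<alpha>\<in>A. class_count x \<alpha> * \<alpha>)" using weight[OF good_S[OF that]] by (simp only: nat_int)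
    also have "\<dots> \<le> (\<Sum>\<alpha>\<in>A. n * \<alpha>)" by (intro sum_mono mult_le_mono1 class_count_le)
    finally show ?thesis by (simp add: sum_distrib_left)
  qed
  ultimately obtain x where x: "good x" and xmax: "\<And>z. good z \<Longrightarrow> nat (w \<bullet> z) \<le> nat (w \<bullet> x)"
    using obtain_maximizer[of good x0 "\<lambda>x. nat (w \<bullet> x)" "n * \<Sum>A"] by metis
  obtain y0 where y0: "signature A K y0 = \<sigma>" "dominates A K x y0" using x unfolding good_def by blast
  have sig: "\<sigma> \<alpha> = min K (class_count y \<alpha>)" if "signature A K y = \<sigma>" "\<alpha> \<in> A" for y \<alpha>
    using that by (auto simp: signature_def)
  have x_large: "K \<le> class_count x \<alpha>" if "\<alpha> \<in> ?L" for \<alpha>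
    using that sig[OF y0(1), of \<alpha>] y0(2) by (auto simp: dominates_def split: if_splits)
  have x_small: "class_count x \<alpha> = \<sigma> \<alpha>" if "\<alpha> \<in> A - ?L" for \<alpha>
    using that sig[OF y0(1), of \<alpha>] y0(2) by (auto simp: dominates_def min_def split: if_splits)
  define c0 where "c0 = (\<Sum>\<alpha>\<in>A - ?L. \<sigma> \<alpha> * \<alpha>)"
  have split: "(\<Sum>\<alpha>\<in>A. c \<alpha> * \<alpha>) = c0 + (\<Sum>\<alpha>\<in>?L. c \<alpha> * \<alpha>)" if "\<And>\<alpha>. \<alpha> \<in> A - ?L \<Longrightarrow> c \<alpha> = \<sigma> \<alpha>" for c
  proof -
    have "(\<Sum>\<alpha>\<in>A. c \<alpha> * \<alpha>) = (\<Sum>\<alpha>\<in>A - ?L. c \<alpha> * \<alpha>) + (\<Sum>\<alpha>\<in>?L. c \<alpha> * \<alpha>)"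
      by (rule sum.subset_diff[OF _ A(1)]) blast
    also have "(\<Sum>\<alpha>\<in>A - ?L. c \<alpha> * \<alpha>) = c0" unfolding c0_def using that by (intro sum.cong) auto
    finally show ?thesis .
  qed
  have "w \<bullet> y \<in> (\<lambda>g. int (c0 + g)) ` gaps ?L (class_count x)"
    if y: "y \<in> S" "f (w \<bullet> y) < b" "signature A K y = \<sigma>" for y
  proof -
    define u where "u = (\<Sum>\<alpha>\<in>?L. class_count y \<alpha> * \<alpha>)"
    have "class_count y \<alpha> = \<sigma> \<alpha>" if "\<alpha> \<in> A - ?L" for \<alpha>
      using that sig[OF y(3), of \<alpha>] by (auto simp: min_def split: if_splits)
    then have wy: "w \<bullet> y = int (c0 + u)" using split[of "class_count y"] weight[OF y(1)] by (simp add: u_def)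
    obtain z where z: "good z" "w \<bullet> y \<le> w \<bullet> z" using ex_good[OF y(1,3)] by blast
    have "0 \<le> w \<bullet> x" unfolding weight[OF good_S[OF x]] by (rule of_nat_0_le_iff)
    then have "w \<bullet> y \<le> w \<bullet> x" using xmax[OF z(1)] z(2) by (simp add: nat_le_eq_zle)
    moreover have "(\<Sum>\<alpha>\<in>A. class_count x \<alpha> * \<alpha>) = c0 + (\<Sum>\<alpha>\<in>?L. class_count x \<alpha> * \<alpha>)"
      by (rule split) (rule x_small)
    ultimately have "int (c0 + u) \<le> int (c0 + (\<Sum>\<alpha>\<in>?L. class_count x \<alpha> * \<alpha>))"
      unfolding wy weight[OF good_S[OF x]] by (simp only:)
    then have le: "u \<le> (\<Sum>\<alpha>\<in>?L. class_count x \<alpha> * \<alpha>)" by linarith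
    have "\<not> (\<exists>c. (\<forall>\<alpha>\<in>?L. c \<alpha> \<le> class_count x \<alpha>) \<and> u = (\<Sum>\<alpha>\<in>?L. c \<alpha> * \<alpha>))"
    proof
      assume "\<exists>c. (\<forall>\<alpha>\<in>?L. c \<alpha> \<le> class_count x \<alpha>) \<and> u = (\<Sum>\<alpha>\<in>?L. c \<alpha> * \<alpha>)"
      then obtain c where c: "\<forall>\<alpha>\<in>?L. c \<alpha> \<le> class_count x \<alpha>" "u = (\<Sum>\<alpha>\<in>?L. c \<alpha> * \<alpha>)" by blast
      define c' where "c' = (\<lambda>\<alpha>. if \<alpha> \<in> ?L then c \<alpha> else \<sigma> \<alpha>)"
      have "\<forall>\<alpha>\<in>A. c' \<alpha> \<le> class_count x \<alpha>" using c(1) x_small by (auto simp: c'_def)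
      then have "b \<le> f (int (\<Sum>\<alpha>\<in>A. c' \<alpha> * \<alpha>))" using x unfolding good_def by blast
      moreover have "(\<Sum>\<alpha>\<in>?L. c' \<alpha> * \<alpha>) = u" unfolding c(2) by (intro sum.cong) (auto simp: c'_def)
      then have "(\<Sum>\<alpha>\<in>A. c' \<alpha> * \<alpha>) = c0 + u" using split[of c'] by (simp add: c'_def)
      ultimately show False using y(2) wy by simp
    qed
    then have "u \<in> gaps ?L (class_count x)" unfolding gaps_def using le u_def by blast
    then show ?thesis using wy by blast
  qed
  then show ?thesis using x_large by (intro exI[of _ "class_count x"] exI[of _ c0]) blast
qed

end

context weighted_system
begin

text \<open>The heavy weights of a signature are those where it reaches the cap \<open>K\<close>.\<close>

lemma search_algorithm_correct:
  assumes a: "distinct a" "\<And>j. j < n \<Longrightarrow> w $ j \<in> int ` set a" and k: "k = K * length a"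
  obtains t s' where
    "exec n LO (comparison_oracle f) (search_algorithm a k) (initial_state n w) t s'"
    "t \<le> poly (time_poly (search_algorithm a k)) n" "result_vec n s' \<in> S"
    "\<And>\<sigma>. \<exists>l c0. (\<forall>\<alpha>\<in>set a. \<sigma> \<alpha> = K \<longrightarrow> K \<le> l \<alpha>) \<and>
       {w \<bullet> y | y. y \<in> S \<and> f (w \<bullet> y) < f (w \<bullet> result_vec n s') \<and> signature (set a) K y = \<sigma>} \<subseteq>
       (\<lambda>g. int (c0 + g)) ` gaps {\<alpha> \<in> set a. \<sigma> \<alpha> = K} l"
proof -
  obtain t s' where run: "exec n LO (comparison_oracle f) (search_algorithm a k) (initial_state n w) t s'"
    "t \<le> poly (time_poly (search_algorithm a k)) n" "result_vec n s' \<in> S"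
    and best: "\<And>h. varies_on (set (parameter_cells a k)) (\<lambda>_ _. 0) h \<Longrightarrow>
      f (w \<bullet> result_vec n s') \<le> f (w \<bullet> candidate k h)"
    using search_algorithm_tries_all[OF a(1), of k] by blast
  have k: "k = K * card (set a)" using k a(1) by (simp add: distinct_card)
  show thesis
  proof (rule that[OF run])
    fix \<sigma>
    show "\<exists>l c0. (\<forall>\<alpha>\<in>set a. \<sigma> \<alpha> = K \<longrightarrow> K \<le> l \<alpha>) \<and>
       {w \<bullet> y | y. y \<in> S \<and> f (w \<bullet> y) < f (w \<bullet> result_vec n s') \<and> signature (set a) K y = \<sigma>} \<subseteq>
       (\<lambda>g. int (c0 + g)) ` gaps {\<alpha> \<in> set a. \<sigma> \<alpha> = K} l"
    proof (rule missed_values_in_gaps)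
      fix T L c
      assume "T \<subseteq> {..<n}" "card T \<le> K * card (set a)" "\<And>\<alpha>. \<alpha> \<in> set a \<Longrightarrow> c \<alpha> \<le> n"
      then obtain h where "varies_on (set (parameter_cells a k)) (\<lambda>_ _. 0) h"
        "candidate k h = thin_out w (LO (objective w (int ` T) (\<lambda>\<alpha>. of_bool (nat \<alpha> \<in> L)))) (\<lambda>\<alpha>. int (c (nat \<alpha>)))"
        using parameters_realize[of a T k c L] a(2) k by auto
      then show "f (w \<bullet> result_vec n s') \<le> f (w \<bullet> thin_out w
          (LO (objective w (int ` T) (\<lambda>\<alpha>. of_bool (nat \<alpha> \<in> L)))) (\<lambda>\<alpha>. int (c (nat \<alpha>))))"
        using best[of h] by simp
    qed (use a(2) in auto)
  qed
qed

lemma signature_in_PiE: "signature A K y \<in> A \<rightarrow>\<^sub>E {..K}"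
  by (auto simp: signature_def)

end

theorem theorem1p1:
  fixes a :: "nat list"
  assumes "primitive_tuple a"
  shows "\<exists>(r :: nat) (alg :: com) (q :: nat poly).
    \<forall>(n :: nat) (S :: int vec set) (LO :: int vec \<Rightarrow> int vec) (w :: int vec) (f :: int \<Rightarrow> real).
      independence_system n S \<longrightarrow> lin_opt_oracle n S LO \<longrightarrow>
      w \<in> carrier_vec n \<longrightarrow> (\<forall>i < n. w $ i \<in> int ` set a) \<longrightarrow>
      (\<exists>t s'. exec n LO (comparison_oracle f) alg (initial_state n w) t s' \<and>
        t \<le> poly q n \<and>
        r_best_solution r S w f (result_vec n s') \<and>
        ((\<forall>i. i + 1 < length a \<longrightarrow> a ! i dvd a ! (i + 1)) \<longrightarrow>
          optimal_solution S w f (result_vec n s')) \<and>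
        (length a = 2 \<longrightarrow> r_best_solution (frobenius a) S w f (result_vec n s')))"
proof -
  have dist: "distinct a" and pos: "\<And>\<alpha>. \<alpha> \<in> set a \<Longrightarrow> 0 < \<alpha>"
    using assms by (auto simp: primitive_tuple_def in_set_conv_nth)
  obtain K0 R where bound: "\<And>L l. L \<subseteq> set a \<Longrightarrow> (\<forall>\<alpha>\<in>L. K0 \<le> l \<alpha>) \<Longrightarrow> card (gaps L l) \<le> R"
    using gaps_uniformly_bounded[of "set a"] pos by blast
  \<comment> \<open>\<open>K0\<close> makes the number of gaps bounded, the sum makes the two special cases work.\<close>
  define K where "K = max K0 (\<Sum>(set a))"
  define alg where "alg = search_algorithm a (K * length a)"
  define \<Sigma> where "\<Sigma> = set a \<rightarrow>\<^sub>E {..K}"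
  define r where "r = card \<Sigma> * R"
  have fin\<Sigma>: "finite \<Sigma>" unfolding \<Sigma>_def by (intro finite_PiE) auto
  have large: "\<beta> \<le> K" if "\<beta> \<in> set a" for \<beta>
    using member_le_sum[of \<beta> "set a" "\<lambda>x. x"] that by (simp add: K_def)
  have run: "\<exists>t s'. exec n LO (comparison_oracle f) alg (initial_state n w) t s' \<and>
        t \<le> poly (time_poly alg) n \<and>
        r_best_solution r S w f (result_vec n s') \<and>
        ((\<forall>i. i + 1 < length a \<longrightarrow> a ! i dvd a ! (i + 1)) \<longrightarrow>
          optimal_solution S w f (result_vec n s')) \<and>
        (length a = 2 \<longrightarrow> r_best_solution (frobenius a) S w f (result_vec n s'))"
    if inst: "independence_system n S" "lin_opt_oracle n S LO" "w \<in> carrier_vec n"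
      "\<forall>i<n. w $ i \<in> int ` set a"
    for n S LO and w :: "int vec" and f :: "int \<Rightarrow> real"
  proof -
    have "0 < w $ j" if j: "j < n" for j
    proof -
      obtain \<alpha> where "\<alpha> \<in> set a" "w $ j = int \<alpha>" using inst(4) j by blast
      then show ?thesis using pos by simp
    qed
    then interpret weighted_system n S LO w f
      using inst by unfold_locales auto
    obtain t s' where exe: "exec n LO (comparison_oracle f) alg (initial_state n w) t s'"
        "t \<le> poly (time_poly alg) n" and res: "result_vec n s' \<in> S"
      and cover: "\<And>\<sigma>. \<exists>l c0. (\<forall>\<alpha>\<in>set a. \<sigma> \<alpha> = K \<longrightarrow> K \<le> l \<alpha>) \<and>
       {w \<bullet> y | y. y \<in> S \<and> f (w \<bullet> y) < f (w \<bullet> result_vec n s') \<and> signature (set a) K y = \<sigma>} \<subseteq>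
       (\<lambda>g. int (c0 + g)) ` gaps {\<alpha> \<in> set a. \<sigma> \<alpha> = K} l"
      using search_algorithm_correct[OF dist, of "K * length a" K] inst(4) unfolding alg_def by blast
    define x where "x = result_vec n s'"
    define Miss where "Miss \<sigma> = {w \<bullet> y | y. y \<in> S \<and> f (w \<bullet> y) < f (w \<bullet> x) \<and> signature (set a) K y = \<sigma>}" for \<sigma>
    define B where "B = {f (w \<bullet> y) | y. f (w \<bullet> y) < f (w \<bullet> x) \<and> y \<in> S}"
    have gaps_cover: "\<exists>l. (\<forall>\<alpha>\<in>{\<alpha> \<in> set a. \<sigma> \<alpha> = K}. K \<le> l \<alpha>) \<and> finite (Miss \<sigma>) \<and>
        card (Miss \<sigma>) \<le> card (gaps {\<alpha> \<in> set a. \<sigma> \<alpha> = K} l)" for \<sigma>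
    proof -
      obtain l c0 where l: "\<forall>\<alpha>\<in>set a. \<sigma> \<alpha> = K \<longrightarrow> K \<le> l \<alpha>"
        and sub: "Miss \<sigma> \<subseteq> (\<lambda>g. int (c0 + g)) ` gaps {\<alpha> \<in> set a. \<sigma> \<alpha> = K} l"
        using cover[of \<sigma>] unfolding Miss_def x_def by blast
      have "finite (Miss \<sigma>)" "card (Miss \<sigma>) \<le> card (gaps {\<alpha> \<in> set a. \<sigma> \<alpha> = K} l)"
        using surj_card_le[OF finite_gaps sub] finite_surj[OF finite_gaps sub] by auto
      then show ?thesis using l by blast
    qed
    have B_union: "B \<subseteq> f ` (\<Union>\<sigma>\<in>\<Sigma>. Miss \<sigma>)"
      using signature_in_PiE[of "set a" K] unfolding B_def Miss_def \<Sigma>_def by blast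
    have finM: "finite (Miss \<sigma>)" for \<sigma> using gaps_cover[of \<sigma>] by blast
    have "card B \<le> card (f ` (\<Union>\<sigma>\<in>\<Sigma>. Miss \<sigma>))"
      using B_union fin\<Sigma> finM by (intro card_mono) auto
    also have "\<dots> \<le> card (\<Union>\<sigma>\<in>\<Sigma>. Miss \<sigma>)" using fin\<Sigma> finM by (intro card_image_le) auto
    also have "\<dots> \<le> (\<Sum>\<sigma>\<in>\<Sigma>. card (Miss \<sigma>))" by (rule card_UN_le[OF fin\<Sigma>])
    finally have card_B: "card B \<le> (\<Sum>\<sigma>\<in>\<Sigma>. card (Miss \<sigma>))" .
    have "card (Miss \<sigma>) \<le> R" for \<sigma>
    proof -
      obtain l where l: "\<forall>\<alpha>\<in>{\<alpha> \<in> set a. \<sigma> \<alpha> = K}. K \<le> l \<alpha>"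
        "card (Miss \<sigma>) \<le> card (gaps {\<alpha> \<in> set a. \<sigma> \<alpha> = K} l)"
        using gaps_cover by blast
      have "card (gaps {\<alpha> \<in> set a. \<sigma> \<alpha> = K} l) \<le> R"
        by (rule bound) (use l(1) in \<open>auto simp: K_def\<close>)
      then show ?thesis using l(2) by simp
    qed
    then have "(\<Sum>\<sigma>\<in>\<Sigma>. card (Miss \<sigma>)) \<le> (\<Sum>\<sigma>\<in>\<Sigma>. R)" by (intro sum_mono)
    then have r_best: "r_best_solution r S w f x"
      using card_B res unfolding r_best_solution_def B_def r_def x_def by simp
    have chain_empty: "Miss \<sigma> = {}"
      if chain: "\<And>\<alpha> \<beta>. \<alpha> \<in> set a \<Longrightarrow> \<beta> \<in> set a \<Longrightarrow> \<sigma> \<alpha> = K \<Longrightarrow> \<sigma> \<beta> = K \<Longrightarrow> \<alpha> dvd \<beta> \<or> \<beta> dvd \<alpha>" for \<sigma>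
    proof -
      obtain l where l: "\<forall>\<alpha>\<in>{\<alpha> \<in> set a. \<sigma> \<alpha> = K}. K \<le> l \<alpha>"
        "card (Miss \<sigma>) \<le> card (gaps {\<alpha> \<in> set a. \<sigma> \<alpha> = K} l)"
        using gaps_cover by blast
      have "gaps {\<alpha> \<in> set a. \<sigma> \<alpha> = K} l = {}"
      proof (rule gaps_divisibility_chain)
        fix \<alpha> \<beta> assume \<alpha>\<beta>: "\<alpha> \<in> {\<alpha> \<in> set a. \<sigma> \<alpha> = K}" "\<beta> \<in> {\<alpha> \<in> set a. \<sigma> \<alpha> = K}"
        then show "\<alpha> dvd \<beta> \<or> \<beta> dvd \<alpha>" using chain[of \<alpha> \<beta>] by simp
        have "K \<le> l \<alpha>" using l(1) \<alpha>\<beta>(1) by blast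
        then show "\<beta> \<le> l \<alpha>" using large[of \<beta>] \<alpha>\<beta>(2) by simp
      qed (use pos in auto)
      then show ?thesis using l(2) finM[of \<sigma>] by simp
    qed
    have optimal: "optimal_solution S w f x" if div: "\<forall>i. i + 1 < length a \<longrightarrow> a ! i dvd a ! (i + 1)"
    proof -
      have dvd: "a ! i dvd a ! j" if "i \<le> j" "j < length a" for i j
        using that
      proof (induction j rule: dec_induct)
        case (step j)
        then have "a ! i dvd a ! j" "a ! j dvd a ! Suc j" using div by simp_all
        then show ?case by (rule dvd_trans)
      qed simp
      have comparable: "\<alpha> dvd \<beta> \<or> \<beta> dvd \<alpha>" if \<alpha>\<beta>: "\<alpha> \<in> set a" "\<beta> \<in> set a" for \<alpha> \<beta>
      proof -
        obtain i j where "i < length a" "\<alpha> = a ! i" "j < length a" "\<beta> = a ! j"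
          using \<alpha>\<beta> by (auto simp: in_set_conv_nth)
        then show ?thesis using dvd[of i j] dvd[of j i] by (cases "i \<le> j") simp_all
      qed
      have "Miss \<sigma> = {}" for \<sigma> by (rule chain_empty) (rule comparable)
      then have "B = {}" using B_union by simp
      then have "\<not> f (w \<bullet> y) < f (w \<bullet> x)" if "y \<in> S" for y using that unfolding B_def by blast
      then show ?thesis using res unfolding optimal_solution_def x_def by (meson not_less)
    qed
    have two: "r_best_solution (frobenius a) S w f x" if len: "length a = 2"
    proof -
      \<comment> \<open>The signature with both weights heavy is the only one that can have gaps.\<close>
      define \<sigma>K where "\<sigma>K = restrict (\<lambda>_. K) (set a)"
      have empty: "Miss \<sigma> = {}" if "\<sigma> \<in> \<Sigma> - {\<sigma>K}" for \<sigma>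
      proof (rule chain_empty)
        fix \<alpha> \<beta> assume \<alpha>\<beta>: "\<alpha> \<in> set a" "\<beta> \<in> set a" "\<sigma> \<alpha> = K" "\<sigma> \<beta> = K"
        have "\<exists>\<gamma>\<in>set a. \<sigma> \<gamma> \<noteq> K"
        proof (rule ccontr)
          assume "\<not> ?thesis"
          then have "\<sigma> = \<sigma>K" using that unfolding \<Sigma>_def \<sigma>K_def by (intro ext) (auto simp: PiE_def extensional_def)
          then show False using that by simp
        qed
        then obtain \<gamma> where "\<gamma> \<in> set a" "\<sigma> \<gamma> \<noteq> K" by blast
        moreover obtain p q where "a = [p, q]" using len by (metis length_0_conv length_Suc_conv numeral_2_eq_2)
        ultimately have "\<alpha> = \<beta>" using \<alpha>\<beta> by auto
        then show "\<alpha> dvd \<beta> \<or> \<beta> dvd \<alpha>" by simp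
      qed
      have "\<sigma>K \<in> \<Sigma>" by (auto simp: \<sigma>K_def \<Sigma>_def)
      then have "(\<Sum>\<sigma>\<in>\<Sigma>. card (Miss \<sigma>)) = card (Miss \<sigma>K)"
        using empty sum.remove[OF fin\<Sigma>, of \<sigma>K "\<lambda>\<sigma>. card (Miss \<sigma>)"] by simp
      moreover have "card (Miss \<sigma>K) \<le> frobenius a"
      proof -
        have all: "{\<alpha> \<in> set a. \<sigma>K \<alpha> = K} = set a" by (auto simp: \<sigma>K_def)
        obtain l where l: "\<forall>\<alpha>\<in>set a. K \<le> l \<alpha>" "card (Miss \<sigma>K) \<le> card (gaps (set a) l)"
          using gaps_cover[of \<sigma>K] unfolding all by blast
        have "card (gaps (set a) l) \<le> frobenius a"
          by (rule card_gaps_two[OF assms len]) (use l(1) in \<open>auto simp: K_def\<close>)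
        then show ?thesis using l(2) by simp
      qed
      ultimately show ?thesis
        using card_B res unfolding r_best_solution_def B_def x_def by simp
    qed
    show ?thesis using exe r_best optimal two unfolding x_def by blast
  qed
  then show ?thesis by blast
qed

end
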